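(* Let $R$ be a commutative ring, let $M$ and $N$ be Lie algebras over $R$ acting on each other, and let $\xi^M_N\colon M\flat N\to N$ and $\xi^N_M\colon N\flat M\to M$ be the corresponding internal actions in the category $\mathbf{Lie}_R$ of Lie algebras over $R$. Then $\xi^M_N$ and $\xi^N_M$ are compatible in the internal (semi-abelian) sense if and only if the two Lie algebra actions are compatible in the sense of Ellis, i.e. if and only if $${}^{({}^{m}n)}m'=[m',{}^{n}m]\qquad\text{and}\qquad{}^{({}^{n}m)}n'=[n',{}^{m}n]$$ for all $m,m'\in M$ and $n,n'\in N$.
   Context: Lie algebra actions: an action of $M$ on $N$ is an $R$-bilinear map $M\times N\to N$, $(m,n)\mapsto{}^mn$, with ${}^{[m,m']}n={}^m({}^{m'}n)-{}^{m'}({}^mn)$ and ${}^m[n,n']=[{}^mn,n']+[n,{}^mn']$. The corresponding internal action $\xi\colon M\flat N\to N$ is the one determined by the split extension $k\colon N\to N\rtimes M$, $\pi\colon N\rtimes M\to M$, $s\colon M\to N\rtimes M$ (the usual semi-direct product of Lie algebras) through $k\circ\xi=\langle s,k\rangle\circ k_{M,N}$, where $\langle s,k\rangle\colon M+N\to N\rtimes M$ is induced by $s$ and $k$; this is a bijective correspondence between Lie algebra actions and internal actions in $\mathbf{Lie}_R$. Internal notation, in the semi-abelian category $\mathbf{Lie}_R$: $+$ is the coproduct (with $A+B$ and $B+A$ identified), $i_A\colon A\to A+B$ and $i_B\colon B\to A+B$ are the inclusions, $\langle f,g\rangle\colon A+B\to C$ is the morphism induced by $f\colon A\to C$, $g\colon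 B\to C$ (and similarly for three summands). The functor $\flat$: $k_{A,B}\colon A\flat B\to A+B$ is the kernel of $\langle 1_A,0\rangle\colon A+B\to A$; for $f\colon A\to A'$, $g\colon B\to B'$, $f\flat g$ is the restriction of $f+g$ to kernels. For fixed $A$, $A\flat(-)$ is a monad with unit $\eta^A_B\colon B\to A\flat B$ determined by $k_{A,B}\circ\eta^A_B=i_B$ and multiplication $\mu^A_B\colon A\flat(A\flat B)\to A\flat B$ determined by $k_{A,B}\circ\mu^A_B=\langle i_A,k_{A,B}\rangle\circ k_{A,A\flat B}$. An internal action of $A$ on $X$ is a morphism $\xi\colon A\flat X\to X$ making $X$ an algebra for this monad. The conjugation action is $\chi_A=\langle 1_A,1_A\rangle\circ k_{A,A}\colon A\flat A\to A$. Cosmash products: $h_{A,B}\colon A\diamond B\to A+B$ is the kernel of the canonical morphism $A+B\to A\times B$; it factors as $h_{A,B}=k_{A,B}\circ i_{A,B}$ with $i_{A,B}\colon A\diamond B\to A\flat B$. $h_{A,B,C}\colon A\diamond B\diamond C\to A+B+C$ is the kernel of the morphism $A+B+C\to(A+B)\times(A+C)\times(B+C)$ with components $\langle i_A,i_B,0\rangle$, $\langle i_A,0,i_C\rangle$, $\langle 0,i_B,i_C\rangle$. The morphism $j_{A,B,C}\colon A\diamond B\diamond C\to(A+B)\flat C$ is the unique one with $k_{A+B,C}\circ j_{A,B,C}=h_{A,B,C}$. The folding morphism $S^{N,M}_{1,2}\colon M\diamond N\diamond M\to N\diamond M$ is the unique one such that $h_{N,M}\circ S^{N,M}_{1,2}$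 equals $h_{M,N,M}$ followed by the morphism $M+N+M\to M+N$ which folds the two copies of $M$ by the codiagonal and is the identity on $N$. Similarly $S^{M,N}_{1,2}\colon M\diamond N\diamond N\to M\diamond N$ is induced by folding the two copies of $N$. Internal compatibility: internal actions $\xi^M_N\colon M\flat N\to N$ and $\xi^N_M\colon N\flat M\to M$ are compatible if there exist internal actions $\xi^{M+N}_M\colon(M+N)\flat M\to M$ and $\xi^{M+N}_N\colon(M+N)\flat N\to N$ such that: (CA.0) $\xi^{M+N}_M\circ(i_N\flat 1_M)=\xi^N_M$, $\ \xi^{M+N}_M\circ(i_M\flat 1_M)=\chi_M$, $\ \xi^{M+N}_M\circ j_{M,N,M}=\xi^N_M\circ i_{N,M}\circ S^{N,M}_{1,2}$, and $\xi^{M+N}_N\circ(i_M\flat 1_N)=\xi^M_N$, $\ \xi^{M+N}_N\circ(i_N\flat 1_N)=\chi_N$, $\ \xi^{M+N}_N\circ j_{M,N,N}=\xi^M_N\circ i_{M,N}\circ S^{M,N}_{1,2}$; (CA.M) $\xi^{M+N}_M\circ\big((\xi^N_M+\xi^M_N)\flat 1_M\big)=\xi^{M+N}_M\circ\big(\langle k_{N,M},k_{M,N}\rangle\flat 1_M\big)$ as morphisms $((N\flat M)+(M\flat N))\flat M\to M$; (CA.N) $\xi^{M+N}_N\circ\big((\xi^N_M+\xi^M_N)\flat 1_N\big)=\xi^{M+N}_N\circ\big(\langle k_{N,M},k_{M,N}\rangle\flat 1_N\big)$ as morphisms $((N\flat M)+(M\flat N))\flat N\to N$. *)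

theory Defs
  imports "HOL-Algebra.Module" "HOL-Algebra.AbelCoset"
begin

section \<open>Lie algebras over a commutative ring\<close>

text \<open>
  The Lie bracket is the multiplication \<open>\<otimes>\<close> of the module record, as the product of an algebra is in
  \<open>HOL-Algebra\<close>. The field \<open>one\<close> of the record carries no meaning here.
\<close>

locale lie_algebra = module R L for R (structure) and L (structure) +
  assumes bracket_closed:
      "\<lbrakk>x \<in> carrier L; y \<in> carrier L\<rbrakk> \<Longrightarrow> x \<otimes>\<^bsub>L\<^esub> y \<in> carrier L"
    and bracket_add_left:
      "\<lbrakk>x \<in> carrier L; y \<in> carrier L; z \<in> carrier L\<rbrakk> \<Longrightarrow>
        (x \<oplus>\<^bsub>L\<^esub> y) \<otimes>\<^bsub>L\<^esub> z = x \<otimes>\<^bsub>L\<^esub> z \<oplus>\<^bsub>L\<^esub> y \<otimes>\<^bsub>L\<^esub> z"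
    and bracket_add_right:
      "\<lbrakk>x \<in> carrier L; y \<in> carrier L; z \<in> carrier L\<rbrakk> \<Longrightarrow>
        z \<otimes>\<^bsub>L\<^esub> (x \<oplus>\<^bsub>L\<^esub> y) = z \<otimes>\<^bsub>L\<^esub> x \<oplus>\<^bsub>L\<^esub> z \<otimes>\<^bsub>L\<^esub> y"
    and bracket_smult_left:
      "\<lbrakk>a \<in> carrier R; x \<in> carrier L; y \<in> carrier L\<rbrakk> \<Longrightarrow>
        (a \<odot>\<^bsub>L\<^esub> x) \<otimes>\<^bsub>L\<^esub> y = a \<odot>\<^bsub>L\<^esub> (x \<otimes>\<^bsub>L\<^esub> y)"
    and bracket_smult_right:
      "\<lbrakk>a \<in> carrier R; x \<in> carrier L; y \<in> carrier L\<rbrakk> \<Longrightarrow>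
        x \<otimes>\<^bsub>L\<^esub> (a \<odot>\<^bsub>L\<^esub> y) = a \<odot>\<^bsub>L\<^esub> (x \<otimes>\<^bsub>L\<^esub> y)"
    and bracket_self:
      "x \<in> carrier L \<Longrightarrow> x \<otimes>\<^bsub>L\<^esub> x = \<zero>\<^bsub>L\<^esub>"
    and jacobi:
      "\<lbrakk>x \<in> carrier L; y \<in> carrier L; z \<in> carrier L\<rbrakk> \<Longrightarrow>
        x \<otimes>\<^bsub>L\<^esub> (y \<otimes>\<^bsub>L\<^esub> z) \<oplus>\<^bsub>L\<^esub> (y \<otimes>\<^bsub>L\<^esub> (z \<otimes>\<^bsub>L\<^esub> x) \<oplus>\<^bsub>L\<^esub> z \<otimes>\<^bsub>L\<^esub> (x \<otimes>\<^bsub>L\<^esub> y)) = \<zero>\<^bsub>L\<^esub>"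

definition lie_hom ::
  "('r, 'k) ring_scheme \<Rightarrow> ('r, 'a, 'x) module_scheme \<Rightarrow> ('r, 'b, 'y) module_scheme \<Rightarrow> ('a \<Rightarrow> 'b) set"
  where "lie_hom R A B = {f \<in> carrier A \<rightarrow> carrier B.
    (\<forall>x\<in>carrier A. \<forall>y\<in>carrier A. f (x \<oplus>\<^bsub>A\<^esub> y) = f x \<oplus>\<^bsub>B\<^esub> f y) \<and>
    (\<forall>a\<in>carrier R. \<forall>x\<in>carrier A. f (a \<odot>\<^bsub>A\<^esub> x) = a \<odot>\<^bsub>B\<^esub> f x) \<and>
    (\<forall>x\<in>carrier A. \<forall>y\<in>carrier A. f (x \<otimes>\<^bsub>A\<^esub> y) = f x \<otimes>\<^bsub>B\<^esub> f y)}"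

text \<open>Two functions represent the same morphism with domain \<open>A\<close> iff they agree on its carrier.\<close>

definition same_morphism :: "('a, 'x) partial_object_scheme \<Rightarrow> ('a \<Rightarrow> 'b) \<Rightarrow> ('a \<Rightarrow> 'b) \<Rightarrow> bool"
  where "same_morphism A f g \<longleftrightarrow> (\<forall>x\<in>carrier A. f x = g x)"

definition zero_morphism :: "('b, 'x) ring_scheme \<Rightarrow> 'a \<Rightarrow> 'b"
  where "zero_morphism B = (\<lambda>_. \<zero>\<^bsub>B\<^esub>)"

definition lie_kernel ::
  "('r, 'a, 'x) module_scheme \<Rightarrow> ('r, 'b, 'y) module_scheme \<Rightarrow> ('a \<Rightarrow> 'b) \<Rightarrow> ('r, 'a, 'x) module_scheme"
  where "lie_kernel A B f = A\<lparr>carrier := a_kernel A B f\<rparr>"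

definition lie_product ::
  "('r, 'a, 'x) module_scheme \<Rightarrow> ('r, 'b, 'y) module_scheme \<Rightarrow> ('r, 'a \<times> 'b) module"
  where "lie_product A B =
    \<lparr>carrier = carrier A \<times> carrier B,
     mult = (\<lambda>(a, b) (a', b'). (a \<otimes>\<^bsub>A\<^esub> a', b \<otimes>\<^bsub>B\<^esub> b')),
     one = undefined,
     zero = (\<zero>\<^bsub>A\<^esub>, \<zero>\<^bsub>B\<^esub>),
     add = (\<lambda>(a, b) (a', b'). (a \<oplus>\<^bsub>A\<^esub> a', b \<oplus>\<^bsub>B\<^esub> b')),
     smult = (\<lambda>r (a, b). (r \<odot>\<^bsub>A\<^esub> a, r \<odot>\<^bsub>B\<^esub> b))\<rparr>"


section \<open>Coproducts\<close>

text \<open>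
  The coproduct \<open>A + B\<close> is presented by the generators \<open>carrier A \<uplus> carrier B\<close>, subject to the axioms
  of Lie algebras and to the relations saying that the inclusions of \<open>A\<close> and \<open>B\<close> are morphisms.
\<close>

datatype (lie_scalars: 'r, lie_gens: 'g) lie_term =
    Gen 'g
  | Zero
  | Add "('r, 'g) lie_term" "('r, 'g) lie_term"
  | Smult 'r "('r, 'g) lie_term"
  | Bracket "('r, 'g) lie_term" "('r, 'g) lie_term"

definition lie_terms ::
  "('r, 'k) ring_scheme \<Rightarrow> ('r, 'a, 'x) module_scheme \<Rightarrow> ('r, 'b, 'y) module_scheme \<Rightarrow>
    ('r, 'a + 'b) lie_term set"
  where "lie_terms R A B =
    {t. lie_scalars t \<subseteq> carrier R \<and> lie_gens t \<subseteq> carrier A <+> carrier B}"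

inductive_set lie_cong ::
  "('r, 'k) ring_scheme \<Rightarrow> ('r, 'a, 'x) module_scheme \<Rightarrow> ('r, 'b, 'y) module_scheme \<Rightarrow>
    (('r, 'a + 'b) lie_term \<times> ('r, 'a + 'b) lie_term) set"
  for R :: "('r, 'k) ring_scheme"
    and A :: "('r, 'a, 'x) module_scheme" and B :: "('r, 'b, 'y) module_scheme"
where
  refl: "t \<in> lie_terms R A B \<Longrightarrow> (t, t) \<in> lie_cong R A B"
| sym: "(s, t) \<in> lie_cong R A B \<Longrightarrow> (t, s) \<in> lie_cong R A B"
| trans: "\<lbrakk>(s, t) \<in> lie_cong R A B; (t, u) \<in> lie_cong R A B\<rbrakk> \<Longrightarrow> (s, u) \<in> lie_cong R A B"
| cong_add: "\<lbrakk>(s, s') \<in> lie_cong R A B; (t, t') \<in> lie_cong R A B\<rbrakk> \<Longrightarrow>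
    (Add s t, Add s' t') \<in> lie_cong R A B"
| cong_smult: "\<lbrakk>a \<in> carrier R; (t, t') \<in> lie_cong R A B\<rbrakk> \<Longrightarrow>
    (Smult a t, Smult a t') \<in> lie_cong R A B"
| cong_bracket: "\<lbrakk>(s, s') \<in> lie_cong R A B; (t, t') \<in> lie_cong R A B\<rbrakk> \<Longrightarrow>
    (Bracket s t, Bracket s' t') \<in> lie_cong R A B"
| add_assoc: "\<lbrakk>s \<in> lie_terms R A B; t \<in> lie_terms R A B; u \<in> lie_terms R A B\<rbrakk> \<Longrightarrow>
    (Add (Add s t) u, Add s (Add t u)) \<in> lie_cong R A B"
| add_comm: "\<lbrakk>s \<in> lie_terms R A B; t \<in> lie_terms R A B\<rbrakk> \<Longrightarrow>
    (Add s t, Add t s) \<in> lie_cong R A B"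
| add_zero: "t \<in> lie_terms R A B \<Longrightarrow> (Add Zero t, t) \<in> lie_cong R A B"
| smult_zero: "t \<in> lie_terms R A B \<Longrightarrow> (Smult \<zero>\<^bsub>R\<^esub> t, Zero) \<in> lie_cong R A B"
| smult_one: "t \<in> lie_terms R A B \<Longrightarrow> (Smult \<one>\<^bsub>R\<^esub> t, t) \<in> lie_cong R A B"
| smult_assoc: "\<lbrakk>a \<in> carrier R; b \<in> carrier R; t \<in> lie_terms R A B\<rbrakk> \<Longrightarrow>
    (Smult (a \<otimes>\<^bsub>R\<^esub> b) t, Smult a (Smult b t)) \<in> lie_cong R A B"
| smult_add_left: "\<lbrakk>a \<in> carrier R; b \<in> carrier R; t \<in> lie_terms R A B\<rbrakk> \<Longrightarrow>
    (Smult (a \<oplus>\<^bsub>R\<^esub> b) t, Add (Smult a t) (Smult b t)) \<in> lie_cong R A B"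
| smult_add_right: "\<lbrakk>a \<in> carrier R; s \<in> lie_terms R A B; t \<in> lie_terms R A B\<rbrakk> \<Longrightarrow>
    (Smult a (Add s t), Add (Smult a s) (Smult a t)) \<in> lie_cong R A B"
| bracket_add_left: "\<lbrakk>s \<in> lie_terms R A B; t \<in> lie_terms R A B; u \<in> lie_terms R A B\<rbrakk> \<Longrightarrow>
    (Bracket (Add s t) u, Add (Bracket s u) (Bracket t u)) \<in> lie_cong R A B"
| bracket_add_right: "\<lbrakk>s \<in> lie_terms R A B; t \<in> lie_terms R A B; u \<in> lie_terms R A B\<rbrakk> \<Longrightarrow>
    (Bracket u (Add s t), Add (Bracket u s) (Bracket u t)) \<in> lie_cong R A B"
| bracket_smult_left: "\<lbrakk>a \<in> carrier R; s \<in> lie_terms R A B; t \<in> lie_terms R A B\<rbrakk> \<Longrightarrow>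
    (Bracket (Smult a s) t, Smult a (Bracket s t)) \<in> lie_cong R A B"
| bracket_smult_right: "\<lbrakk>a \<in> carrier R; s \<in> lie_terms R A B; t \<in> lie_terms R A B\<rbrakk> \<Longrightarrow>
    (Bracket s (Smult a t), Smult a (Bracket s t)) \<in> lie_cong R A B"
| bracket_self: "t \<in> lie_terms R A B \<Longrightarrow> (Bracket t t, Zero) \<in> lie_cong R A B"
| jacobi: "\<lbrakk>s \<in> lie_terms R A B; t \<in> lie_terms R A B; u \<in> lie_terms R A B\<rbrakk> \<Longrightarrow>
    (Add (Bracket s (Bracket t u)) (Add (Bracket t (Bracket u s)) (Bracket u (Bracket s t))), Zero)
      \<in> lie_cong R A B"
| inl_add: "\<lbrakk>a \<in> carrier A; a' \<in> carrier A\<rbrakk> \<Longrightarrow>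
    (Gen (Inl (a \<oplus>\<^bsub>A\<^esub> a')), Add (Gen (Inl a)) (Gen (Inl a'))) \<in> lie_cong R A B"
| inl_smult: "\<lbrakk>r \<in> carrier R; a \<in> carrier A\<rbrakk> \<Longrightarrow>
    (Gen (Inl (r \<odot>\<^bsub>A\<^esub> a)), Smult r (Gen (Inl a))) \<in> lie_cong R A B"
| inl_bracket: "\<lbrakk>a \<in> carrier A; a' \<in> carrier A\<rbrakk> \<Longrightarrow>
    (Gen (Inl (a \<otimes>\<^bsub>A\<^esub> a')), Bracket (Gen (Inl a)) (Gen (Inl a'))) \<in> lie_cong R A B"
| inr_add: "\<lbrakk>b \<in> carrier B; b' \<in> carrier B\<rbrakk> \<Longrightarrow>
    (Gen (Inr (b \<oplus>\<^bsub>B\<^esub> b')), Add (Gen (Inr b)) (Gen (Inr b'))) \<in> lie_cong R A B"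
| inr_smult: "\<lbrakk>r \<in> carrier R; b \<in> carrier B\<rbrakk> \<Longrightarrow>
    (Gen (Inr (r \<odot>\<^bsub>B\<^esub> b)), Smult r (Gen (Inr b))) \<in> lie_cong R A B"
| inr_bracket: "\<lbrakk>b \<in> carrier B; b' \<in> carrier B\<rbrakk> \<Longrightarrow>
    (Gen (Inr (b \<otimes>\<^bsub>B\<^esub> b')), Bracket (Gen (Inr b)) (Gen (Inr b'))) \<in> lie_cong R A B"

definition coproduct ::
  "('r, 'k) ring_scheme \<Rightarrow> ('r, 'a, 'x) module_scheme \<Rightarrow> ('r, 'b, 'y) module_scheme \<Rightarrow>
    ('r, ('r, 'a + 'b) lie_term set) module"
  where "coproduct R A B =
    \<lparr>carrier = lie_terms R A B // lie_cong R A B,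
     mult = (\<lambda>X Y. \<Union>s\<in>X. \<Union>t\<in>Y. lie_cong R A B `` {Bracket s t}),
     one = undefined,
     zero = lie_cong R A B `` {Zero},
     add = (\<lambda>X Y. \<Union>s\<in>X. \<Union>t\<in>Y. lie_cong R A B `` {Add s t}),
     smult = (\<lambda>a X. \<Union>t\<in>X. lie_cong R A B `` {Smult a t})\<rparr>"

definition coprod_inl ::
  "('r, 'k) ring_scheme \<Rightarrow> ('r, 'a, 'x) module_scheme \<Rightarrow> ('r, 'b, 'y) module_scheme \<Rightarrow>
    'a \<Rightarrow> ('r, 'a + 'b) lie_term set"
  where "coprod_inl R A B = (\<lambda>a. lie_cong R A B `` {Gen (Inl a)})"

definition coprod_inr ::
  "('r, 'k) ring_scheme \<Rightarrow> ('r, 'a, 'x) module_scheme \<Rightarrow> ('r, 'b, 'y) module_scheme \<Rightarrow>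
    'b \<Rightarrow> ('r, 'a + 'b) lie_term set"
  where "coprod_inr R A B = (\<lambda>b. lie_cong R A B `` {Gen (Inr b)})"

primrec lie_eval :: "('r, 'c, 'z) module_scheme \<Rightarrow> ('g \<Rightarrow> 'c) \<Rightarrow> ('r, 'g) lie_term \<Rightarrow> 'c"
where
  "lie_eval C f (Gen g) = f g"
| "lie_eval C f Zero = \<zero>\<^bsub>C\<^esub>"
| "lie_eval C f (Add s t) = lie_eval C f s \<oplus>\<^bsub>C\<^esub> lie_eval C f t"
| "lie_eval C f (Smult a t) = a \<odot>\<^bsub>C\<^esub> lie_eval C f t"
| "lie_eval C f (Bracket s t) = lie_eval C f s \<otimes>\<^bsub>C\<^esub> lie_eval C f t"

text \<open>
  \<open>\<langle>f, g\<rangle> : A + B \<rightarrow> C\<close>; all representatives of a class have the same value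
  (see the universal property below).
\<close>

definition copair ::
  "('r, 'c, 'z) module_scheme \<Rightarrow> ('a \<Rightarrow> 'c) \<Rightarrow> ('b \<Rightarrow> 'c) \<Rightarrow> ('r, 'a + 'b) lie_term set \<Rightarrow> 'c"
  where "copair C f g = (\<lambda>X. the_elem (lie_eval C (case_sum f g) ` X))"

text \<open>\<open>f + g : A + B \<rightarrow> A' + B'\<close>.\<close>

definition coprod_map ::
  "('r, 'k) ring_scheme \<Rightarrow> ('r, 'c, 'x) module_scheme \<Rightarrow> ('r, 'd, 'y) module_scheme \<Rightarrow>
    ('a \<Rightarrow> 'c) \<Rightarrow> ('b \<Rightarrow> 'd) \<Rightarrow> ('r, 'a + 'b) lie_term set \<Rightarrow> ('r, 'c + 'd) lie_term set"
  where "coprod_map R A' B' f g =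
    copair (coproduct R A' B') (coprod_inl R A' B' \<circ> f) (coprod_inr R A' B' \<circ> g)"

text \<open>The identification \<open>B + A \<cong> A + B\<close>.\<close>

definition coprod_swap ::
  "('r, 'k) ring_scheme \<Rightarrow> ('r, 'a, 'x) module_scheme \<Rightarrow> ('r, 'b, 'y) module_scheme \<Rightarrow>
    ('r, 'b + 'a) lie_term set \<Rightarrow> ('r, 'a + 'b) lie_term set"
  where "coprod_swap R A B = copair (coproduct R A B) (coprod_inr R A B) (coprod_inl R A B)"

text \<open>The ternary coproduct is \<open>A + B + C = (A + B) + C\<close>, and \<open>\<langle>f, g, h\<rangle> = \<langle>\<langle>f, g\<rangle>, h\<rangle>\<close>.\<close>

definition coproduct3 ::
  "('r, 'k) ring_scheme \<Rightarrow> ('r, 'a, 'x) module_scheme \<Rightarrow> ('r, 'b, 'y) module_scheme \<Rightarrow>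
    ('r, 'c, 'z) module_scheme \<Rightarrow> ('r, ('r, ('r, 'a + 'b) lie_term set + 'c) lie_term set) module"
  where "coproduct3 R A B C = coproduct R (coproduct R A B) C"

definition copair3 ::
  "('r, 'd, 'z) module_scheme \<Rightarrow> ('a \<Rightarrow> 'd) \<Rightarrow> ('b \<Rightarrow> 'd) \<Rightarrow> ('c \<Rightarrow> 'd) \<Rightarrow>
    ('r, ('r, 'a + 'b) lie_term set + 'c) lie_term set \<Rightarrow> 'd"
  where "copair3 D f g h = copair D (copair D f g) h"


subsection \<open>The universal property\<close>

context
  fixes R :: "('r, 'k) ring_scheme"
    and A :: "('r, 'a, 'x) module_scheme" and B :: "('r, 'b, 'y) module_scheme"
  assumes A: "lie_algebra R A" and B: "lie_algebra R B"
begin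

interpretation A: lie_algebra R A by (rule A)
interpretation B: lie_algebra R B by (rule B)

lemma lie_terms_simps:
  "Gen (Inl a) \<in> lie_terms R A B \<longleftrightarrow> a \<in> carrier A"
  "Gen (Inr b) \<in> lie_terms R A B \<longleftrightarrow> b \<in> carrier B"
  "Zero \<in> lie_terms R A B"
  "Add s t \<in> lie_terms R A B \<longleftrightarrow> s \<in> lie_terms R A B \<and> t \<in> lie_terms R A B"
  "Smult r t \<in> lie_terms R A B \<longleftrightarrow> r \<in> carrier R \<and> t \<in> lie_terms R A B"
  "Bracket s t \<in> lie_terms R A B \<longleftrightarrow> s \<in> lie_terms R A B \<and> t \<in> lie_terms R A B"
  by (auto simp: lie_terms_def)

lemma lie_cong_terms:
  "(s, t) \<in> lie_cong R A B \<Longrightarrow> s \<in> lie_terms R A B \<and> t \<in> lie_terms R A B"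
  by (induction rule: lie_cong.induct) (auto simp: lie_terms_simps A.bracket_closed B.bracket_closed)

lemma equiv_lie_cong: "equiv (lie_terms R A B) (lie_cong R A B)"
  by (rule equivI)
    (auto intro!: refl_onI symI transI dest: lie_cong_terms
      intro: lie_cong.refl lie_cong.sym lie_cong.trans)

abbreviation (input) cls :: "('r, 'a + 'b) lie_term \<Rightarrow> ('r, 'a + 'b) lie_term set"
  where "cls t \<equiv> lie_cong R A B `` {t}"

lemma class_eq_iff:
  "s \<in> lie_terms R A B \<Longrightarrow> t \<in> lie_terms R A B \<Longrightarrow> cls s = cls t \<longleftrightarrow> (s, t) \<in> lie_cong R A B"
  by (rule eq_equiv_class_iff[OF equiv_lie_cong])

lemma coproduct_carrier: "carrier (coproduct R A B) = cls ` lie_terms R A B"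
  by (auto simp: coproduct_def quotient_def)

lemma coproduct_ops:
  assumes "s \<in> lie_terms R A B" "t \<in> lie_terms R A B"
  shows "cls s \<oplus>\<^bsub>coproduct R A B\<^esub> cls t = cls (Add s t)"
    and "cls s \<otimes>\<^bsub>coproduct R A B\<^esub> cls t = cls (Bracket s t)"
proof -
  have *: "(\<lambda>s t. cls (Add s t)) respects2 lie_cong R A B"
    "(\<lambda>s t. cls (Bracket s t)) respects2 lie_cong R A B"
    by (auto simp only: congruent2_def split: prod.splits
        intro!: equiv_class_eq[OF equiv_lie_cong] lie_cong.cong_add lie_cong.cong_bracket)
  show "cls s \<oplus>\<^bsub>coproduct R A B\<^esub> cls t = cls (Add s t)"
    using UN_equiv_class2[OF equiv_lie_cong equiv_lie_cong *(1) assms] by (simp add: coproduct_def)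
  show "cls s \<otimes>\<^bsub>coproduct R A B\<^esub> cls t = cls (Bracket s t)"
    using UN_equiv_class2[OF equiv_lie_cong equiv_lie_cong *(2) assms] by (simp add: coproduct_def)
qed

lemma coproduct_smult:
  assumes "r \<in> carrier R" "t \<in> lie_terms R A B"
  shows "r \<odot>\<^bsub>coproduct R A B\<^esub> cls t = cls (Smult r t)"
  unfolding coproduct_def
  using assms
  by (auto intro!: UN_equiv_class[OF equiv_lie_cong]
      simp: congruent_def intro!: equiv_class_eq[OF equiv_lie_cong] intro: lie_cong.cong_smult)

lemma coproduct_zero: "\<zero>\<^bsub>coproduct R A B\<^esub> = cls Zero"
  by (simp add: coproduct_def)

lemmas coproduct_simps = coproduct_carrier coproduct_ops coproduct_smult coproduct_zero

lemma lie_algebra_coproduct: "lie_algebra R (coproduct R A B)"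
proof -
  note c = coproduct_simps lie_terms_simps class_eq_iff
    lie_cong.add_assoc lie_cong.add_comm lie_cong.add_zero
    lie_cong.smult_one lie_cong.smult_assoc lie_cong.smult_add_left lie_cong.smult_add_right
    lie_cong.bracket_add_left lie_cong.bracket_add_right
    lie_cong.bracket_smult_left lie_cong.bracket_smult_right lie_cong.bracket_self lie_cong.jacobi
  have ag: "abelian_group (coproduct R A B)"
  proof (rule abelian_groupI)
    fix X assume "X \<in> carrier (coproduct R A B)"
    then obtain t where t: "t \<in> lie_terms R A B" "X = cls t" by (auto simp: c)
    let ?n = "Smult (\<ominus>\<^bsub>R\<^esub> \<one>\<^bsub>R\<^esub>) t"
    have n: "?n \<in> lie_terms R A B" using t by (simp add: lie_terms_simps)
    have "(Add ?n t, Add ?n (Smult \<one>\<^bsub>R\<^esub> t)) \<in> lie_cong R A B"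
      using t n by (intro lie_cong.cong_add lie_cong.refl lie_cong.sym[OF lie_cong.smult_one])
    moreover have "(Add ?n (Smult \<one>\<^bsub>R\<^esub> t), Smult (\<ominus>\<^bsub>R\<^esub> \<one>\<^bsub>R\<^esub> \<oplus>\<^bsub>R\<^esub> \<one>\<^bsub>R\<^esub>) t) \<in> lie_cong R A B"
      using t by (intro lie_cong.sym[OF lie_cong.smult_add_left]) auto
    moreover have "(Smult (\<ominus>\<^bsub>R\<^esub> \<one>\<^bsub>R\<^esub> \<oplus>\<^bsub>R\<^esub> \<one>\<^bsub>R\<^esub>) t, Zero) \<in> lie_cong R A B"
      using t lie_cong.smult_zero[of t] by (simp add: A.R.l_neg)
    ultimately have "(Add ?n t, Zero) \<in> lie_cong R A B" by (blast intro: lie_cong.trans)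
    then show "\<exists>Y\<in>carrier (coproduct R A B). Y \<oplus>\<^bsub>coproduct R A B\<^esub> X = \<zero>\<^bsub>coproduct R A B\<^esub>"
      using t n by (intro bexI[of _ "cls ?n"]) (auto simp: c)
  qed (auto simp: c del: equalityI)
  have "module R (coproduct R A B)"
    by (rule moduleI[OF A.R.cring_axioms ag]) (auto simp: c del: equalityI)
  then show ?thesis
    unfolding lie_algebra_def lie_algebra_axioms_def
    by (auto simp: c del: equalityI)
qed

lemma coprod_inl_hom: "coprod_inl R A B \<in> lie_hom R A (coproduct R A B)"
  and coprod_inr_hom: "coprod_inr R A B \<in> lie_hom R B (coproduct R A B)"
  by (auto simp: lie_hom_def coprod_inl_def coprod_inr_def coproduct_simps lie_terms_simps
      class_eq_iff A.bracket_closed B.bracket_closed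
      lie_cong.inl_add lie_cong.inl_smult lie_cong.inl_bracket
      lie_cong.inr_add lie_cong.inr_smult lie_cong.inr_bracket del: equalityI)

context
  fixes C :: "('r, 'c, 'z) module_scheme" and f g
  assumes C: "lie_algebra R C" and f: "f \<in> lie_hom R A C" and g: "g \<in> lie_hom R B C"
begin

interpretation C: lie_algebra R C by (rule C)

lemma lie_eval_closed:
  "t \<in> lie_terms R A B \<Longrightarrow> lie_eval C (case_sum f g) t \<in> carrier C"
  using f g
  by (induction t) (auto simp: lie_terms_def lie_hom_def C.bracket_closed)

lemma lie_eval_cong:
  "(s, t) \<in> lie_cong R A B \<Longrightarrow> lie_eval C (case_sum f g) s = lie_eval C (case_sum f g) t"
proof (induction rule: lie_cong.induct)
  case (sym s t) show ?case by (rule HOL.sym[OF sym.IH])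
next
  case (trans s t u) show ?case by (rule HOL.trans[OF trans.IH])
next
  case add_comm then show ?case by (simp add: lie_eval_closed C.a_comm)
next
  case inl_add then show ?case using f by (simp add: lie_hom_def)
next
  case inl_smult then show ?case using f by (simp add: lie_hom_def)
next
  case inl_bracket then show ?case using f by (simp add: lie_hom_def)
next
  case inr_add then show ?case using g by (simp add: lie_hom_def)
next
  case inr_smult then show ?case using g by (simp add: lie_hom_def)
next
  case inr_bracket then show ?case using g by (simp add: lie_hom_def)
qed (simp_all add: lie_eval_closed C.a_assoc C.smult_assoc1 C.smult_l_distr C.smult_r_distr
    C.bracket_add_left C.bracket_add_right C.bracket_smult_left C.bracket_smult_right
    C.bracket_self C.jacobi)

lemma copair_class:
  assumes "t \<in> lie_terms R A B"
  shows "copair C f g (cls t) = lie_eval C (case_sum f g) t"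
proof -
  have "lie_eval C (case_sum f g) ` cls t = {lie_eval C (case_sum f g) t}"
  proof (intro equalityI subsetI)
    fix c assume "c \<in> lie_eval C (case_sum f g) ` cls t"
    then obtain s where "(t, s) \<in> lie_cong R A B" "c = lie_eval C (case_sum f g) s" by blast
    then show "c \<in> {lie_eval C (case_sum f g) t}" using lie_eval_cong[of t s] by simp
  next
    fix c assume "c \<in> {lie_eval C (case_sum f g) t}"
    then show "c \<in> lie_eval C (case_sum f g) ` cls t" using lie_cong.refl[OF assms] by blast
  qed
  then show ?thesis by (simp add: copair_def)
qed

lemma copair_hom: "copair C f g \<in> lie_hom R (coproduct R A B) C"
  by (auto simp: lie_hom_def[of R "coproduct R A B"] coproduct_simps copair_class lie_terms_simps
      lie_eval_closed)

lemma copair_inl: "same_morphism A (copair C f g \<circ> coprod_inl R A B) f"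
  and copair_inr: "same_morphism B (copair C f g \<circ> coprod_inr R A B) g"
  by (auto simp: same_morphism_def coprod_inl_def coprod_inr_def copair_class lie_terms_simps)

lemma copair_unique:
  assumes h: "h \<in> lie_hom R (coproduct R A B) C"
    and inl: "same_morphism A (h \<circ> coprod_inl R A B) f"
    and inr: "same_morphism B (h \<circ> coprod_inr R A B) g"
  shows "same_morphism (coproduct R A B) h (copair C f g)"
proof -
  interpret P: lie_algebra R "coproduct R A B" by (rule lie_algebra_coproduct)
  have z: "h (cls Zero) = \<zero>\<^bsub>C\<^esub>"
  proof -
    let ?z = "\<zero>\<^bsub>coproduct R A B\<^esub>"
    have "h ?z = h (\<zero>\<^bsub>R\<^esub> \<odot>\<^bsub>coproduct R A B\<^esub> ?z)" by simp
    also have "\<dots> = \<zero>\<^bsub>R\<^esub> \<odot>\<^bsub>C\<^esub> h ?z" using h by (simp add: lie_hom_def del: P.smult_l_null P.smult_r_null)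
    also have "\<dots> = \<zero>\<^bsub>C\<^esub>" using h by (intro C.smult_l_null) (auto simp: lie_hom_def)
    finally show ?thesis by (simp add: coproduct_zero)
  qed
  have "h (cls t) = lie_eval C (case_sum f g) t" if "t \<in> lie_terms R A B" for t
    using that
  proof (induction t)
    case (Gen x)
    then show ?case using inl inr
      by (cases x) (auto simp: same_morphism_def coprod_inl_def coprod_inr_def lie_terms_simps)
  next
    case Zero
    show ?case using z by simp
  next
    case (Add s t)
    then have *: "s \<in> lie_terms R A B" "t \<in> lie_terms R A B" by (auto simp: lie_terms_simps)
    then have "h (cls s \<oplus>\<^bsub>coproduct R A B\<^esub> cls t) = h (cls s) \<oplus>\<^bsub>C\<^esub> h (cls t)"
      using h by (simp add: lie_hom_def coproduct_carrier)
    then show ?case using * Add.IH by (simp add: coproduct_ops)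
  next
    case (Smult r t)
    then have *: "r \<in> carrier R" "t \<in> lie_terms R A B" by (auto simp: lie_terms_simps)
    then have "h (r \<odot>\<^bsub>coproduct R A B\<^esub> cls t) = r \<odot>\<^bsub>C\<^esub> h (cls t)"
      using h by (simp add: lie_hom_def coproduct_carrier)
    then show ?case using * Smult.IH by (simp add: coproduct_smult)
  next
    case (Bracket s t)
    then have *: "s \<in> lie_terms R A B" "t \<in> lie_terms R A B" by (auto simp: lie_terms_simps)
    then have "h (cls s \<otimes>\<^bsub>coproduct R A B\<^esub> cls t) = h (cls s) \<otimes>\<^bsub>C\<^esub> h (cls t)"
      using h by (simp add: lie_hom_def coproduct_carrier)
    then show ?case using * Bracket.IH by (simp add: coproduct_ops)
  qed
  then show ?thesis by (auto simp: same_morphism_def coproduct_carrier copair_class)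
qed

end

end


section \<open>The functor \<open>\<flat>\<close> and internal actions\<close>

text \<open>
  Kernels are realised as subalgebras, so that the kernel morphisms \<open>k\<close> and \<open>h\<close>, and the
  factorisations of one kernel morphism through another one, are inclusions of carriers.
\<close>

definition flat ::
  "('r, 'k) ring_scheme \<Rightarrow> ('r, 'a, 'x) module_scheme \<Rightarrow> ('r, 'b, 'y) module_scheme \<Rightarrow>
    ('r, ('r, 'a + 'b) lie_term set) module"
  where "flat R A B = lie_kernel (coproduct R A B) A (copair A id (zero_morphism A))"

definition flat_incl ::
  "('r, 'k) ring_scheme \<Rightarrow> ('r, 'a, 'x) module_scheme \<Rightarrow> ('r, 'b, 'y) module_scheme \<Rightarrow>
    ('r, 'a + 'b) lie_term set \<Rightarrow> ('r, 'a + 'b) lie_term set"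
  where "flat_incl R A B = (\<lambda>x\<in>carrier (flat R A B). x)"

text \<open>\<open>f \<flat> g : A \<flat> B \<rightarrow> A' \<flat> B'\<close> is the restriction of \<open>f + g\<close>.\<close>

definition flat_map ::
  "('r, 'k) ring_scheme \<Rightarrow> ('r, 'a, 'x) module_scheme \<Rightarrow> ('r, 'b, 'y) module_scheme \<Rightarrow>
    ('r, 'c, 'u) module_scheme \<Rightarrow> ('r, 'd, 'v) module_scheme \<Rightarrow>
    ('a \<Rightarrow> 'c) \<Rightarrow> ('b \<Rightarrow> 'd) \<Rightarrow> ('r, 'a + 'b) lie_term set \<Rightarrow> ('r, 'c + 'd) lie_term set"
  where "flat_map R A B A' B' f g = (\<lambda>x\<in>carrier (flat R A B). coprod_map R A' B' f g x)"

text \<open>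
  The unit and the multiplication of the monad \<open>A \<flat> (-)\<close>, given by their composites with the inclusion
  \<open>k : A \<flat> B \<rightarrow> A + B\<close>.
\<close>

definition flat_unit ::
  "('r, 'k) ring_scheme \<Rightarrow> ('r, 'a, 'x) module_scheme \<Rightarrow> ('r, 'b, 'y) module_scheme \<Rightarrow>
    'b \<Rightarrow> ('r, 'a + 'b) lie_term set"
  where "flat_unit R A B = coprod_inr R A B"

definition flat_mult ::
  "('r, 'k) ring_scheme \<Rightarrow> ('r, 'a, 'x) module_scheme \<Rightarrow> ('r, 'b, 'y) module_scheme \<Rightarrow>
    ('r, 'a + ('r, 'a + 'b) lie_term set) lie_term set \<Rightarrow> ('r, 'a + 'b) lie_term set"
  where "flat_mult R A B =
    copair (coproduct R A B) (coprod_inl R A B) (flat_incl R A B) \<circ> flat_incl R A (flat R A B)"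

definition internal_action ::
  "('r, 'k) ring_scheme \<Rightarrow> ('r, 'a, 'x) module_scheme \<Rightarrow> ('r, 'b, 'y) module_scheme \<Rightarrow>
    (('r, 'a + 'b) lie_term set \<Rightarrow> 'b) \<Rightarrow> bool"
  where "internal_action R A X \<xi> \<longleftrightarrow>
    \<xi> \<in> lie_hom R (flat R A X) X \<and>
    same_morphism X (\<xi> \<circ> flat_unit R A X) id \<and>
    same_morphism (flat R A (flat R A X))
      (\<xi> \<circ> flat_mult R A X) (\<xi> \<circ> flat_map R A (flat R A X) A X id \<xi>)"

definition conjugation_action ::
  "('r, 'k) ring_scheme \<Rightarrow> ('r, 'a, 'x) module_scheme \<Rightarrow> ('r, 'a + 'a) lie_term set \<Rightarrow> 'a"
  where "conjugation_action R A = copair A id id \<circ> flat_incl R A A"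


section \<open>Cosmash products\<close>

definition cosmash ::
  "('r, 'k) ring_scheme \<Rightarrow> ('r, 'a, 'x) module_scheme \<Rightarrow> ('r, 'b, 'y) module_scheme \<Rightarrow>
    ('r, ('r, 'a + 'b) lie_term set) module"
  where "cosmash R A B = lie_kernel (coproduct R A B) (lie_product A B)
    (\<lambda>x. (copair A id (zero_morphism A) x, copair B (zero_morphism B) id x))"

definition cosmash_incl_flat ::
  "('r, 'k) ring_scheme \<Rightarrow> ('r, 'a, 'x) module_scheme \<Rightarrow> ('r, 'b, 'y) module_scheme \<Rightarrow>
    ('r, 'a + 'b) lie_term set \<Rightarrow> ('r, 'a + 'b) lie_term set"
  where "cosmash_incl_flat R A B = (\<lambda>x\<in>carrier (cosmash R A B). x)"

definition cosmash3 ::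
  "('r, 'k) ring_scheme \<Rightarrow> ('r, 'a, 'x) module_scheme \<Rightarrow> ('r, 'b, 'y) module_scheme \<Rightarrow>
    ('r, 'c, 'z) module_scheme \<Rightarrow> ('r, ('r, ('r, 'a + 'b) lie_term set + 'c) lie_term set) module"
  where "cosmash3 R A B C =
    (let AB = coproduct R A B; AC = coproduct R A C; BC = coproduct R B C in
      lie_kernel (coproduct3 R A B C) (lie_product AB (lie_product AC BC))
        (\<lambda>x. (copair3 AB (coprod_inl R A B) (coprod_inr R A B) (zero_morphism AB) x,
              copair3 AC (coprod_inl R A C) (zero_morphism AC) (coprod_inr R A C) x,
              copair3 BC (zero_morphism BC) (coprod_inl R B C) (coprod_inr R B C) x)))"

text \<open>\<open>h : A \<diamond> B \<diamond> C \<rightarrow> A + B + C\<close>\<close>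

definition cosmash3_incl ::
  "('r, 'k) ring_scheme \<Rightarrow> ('r, 'a, 'x) module_scheme \<Rightarrow> ('r, 'b, 'y) module_scheme \<Rightarrow>
    ('r, 'c, 'z) module_scheme \<Rightarrow> ('r, ('r, 'a + 'b) lie_term set + 'c) lie_term set \<Rightarrow>
    ('r, ('r, 'a + 'b) lie_term set + 'c) lie_term set"
  where "cosmash3_incl R A B C = (\<lambda>x\<in>carrier (cosmash3 R A B C). x)"

text \<open>
  \<open>j : A \<diamond> B \<diamond> C \<rightarrow> (A + B) \<flat> C\<close>. Its composite with the inclusion \<open>k\<close> of \<open>(A + B) \<flat> C\<close> into
  \<open>(A + B) + C = A + B + C\<close> has to be \<open>h\<close>, so that on elements it is \<open>h\<close>.
\<close>

definition cosmash3_incl_flat ::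
  "('r, 'k) ring_scheme \<Rightarrow> ('r, 'a, 'x) module_scheme \<Rightarrow> ('r, 'b, 'y) module_scheme \<Rightarrow>
    ('r, 'c, 'z) module_scheme \<Rightarrow> ('r, ('r, 'a + 'b) lie_term set + 'c) lie_term set \<Rightarrow>
    ('r, ('r, 'a + 'b) lie_term set + 'c) lie_term set"
  where "cosmash3_incl_flat R A B C = cosmash3_incl R A B C"

text \<open>
  The folding morphisms \<open>M \<diamond> N \<diamond> M \<rightarrow> N \<diamond> M\<close> and \<open>M \<diamond> N \<diamond> N \<rightarrow> M \<diamond> N\<close>, again given by their composites
  with the inclusions of \<open>N \<diamond> M\<close> into \<open>N + M\<close> and of \<open>M \<diamond> N\<close> into \<open>M + N\<close>.
\<close>

definition fold_MNM ::
  "('r, 'k) ring_scheme \<Rightarrow> ('r, 'm, 'x) module_scheme \<Rightarrow> ('r, 'n, 'y) module_scheme \<Rightarrow>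
    ('r, ('r, 'm + 'n) lie_term set + 'm) lie_term set \<Rightarrow> ('r, 'n + 'm) lie_term set"
  where "fold_MNM R M N =
    copair3 (coproduct R N M) (coprod_inr R N M) (coprod_inl R N M) (coprod_inr R N M)
      \<circ> cosmash3_incl R M N M"

definition fold_MNN ::
  "('r, 'k) ring_scheme \<Rightarrow> ('r, 'm, 'x) module_scheme \<Rightarrow> ('r, 'n, 'y) module_scheme \<Rightarrow>
    ('r, ('r, 'm + 'n) lie_term set + 'n) lie_term set \<Rightarrow> ('r, 'm + 'n) lie_term set"
  where "fold_MNN R M N =
    copair3 (coproduct R M N) (coprod_inl R M N) (coprod_inr R M N) (coprod_inr R M N)
      \<circ> cosmash3_incl R M N N"


section \<open>Internal compatibility\<close>

text \<open>
  Below, \<open>\<xi>\<xi>\<close> is \<open>\<xi>NM + \<xi>MN : (N \<flat> M) + (M \<flat> N) \<rightarrow> M + N\<close> and \<open>kk\<close> is the morphism between the same objects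
  induced by the inclusions of \<open>N \<flat> M\<close> and \<open>M \<flat> N\<close>, where \<open>N + M\<close> is identified with \<open>M + N\<close>.
\<close>

definition internally_compatible ::
  "('r, 'k) ring_scheme \<Rightarrow> ('r, 'm, 'x) module_scheme \<Rightarrow> ('r, 'n, 'y) module_scheme \<Rightarrow>
    (('r, 'm + 'n) lie_term set \<Rightarrow> 'n) \<Rightarrow> (('r, 'n + 'm) lie_term set \<Rightarrow> 'm) \<Rightarrow> bool"
  where "internally_compatible R M N \<xi>MN \<xi>NM \<longleftrightarrow>
    internal_action R M N \<xi>MN \<and> internal_action R N M \<xi>NM \<and>
    (let MN = coproduct R M N;
         iM = coprod_inl R M N;
         iN = coprod_inr R M N;
         K = coproduct R (flat R N M) (flat R M N);
         \<xi>\<xi> = coprod_map R M N \<xi>NM \<xi>MN;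
         kk = copair MN (coprod_swap R M N \<circ> flat_incl R N M) (flat_incl R M N)
     in \<exists>\<xi>M \<xi>N. internal_action R MN M \<xi>M \<and> internal_action R MN N \<xi>N \<and>
       same_morphism (flat R N M) (\<xi>M \<circ> flat_map R N M MN M iN id) \<xi>NM \<and>
       same_morphism (flat R M M) (\<xi>M \<circ> flat_map R M M MN M iM id) (conjugation_action R M) \<and>
       same_morphism (cosmash3 R M N M)
         (\<xi>M \<circ> cosmash3_incl_flat R M N M) (\<xi>NM \<circ> cosmash_incl_flat R N M \<circ> fold_MNM R M N) \<and>
       same_morphism (flat R M N) (\<xi>N \<circ> flat_map R M N MN N iM id) \<xi>MN \<and>
       same_morphism (flat R N N) (\<xi>N \<circ> flat_map R N N MN N iN id) (conjugation_action R N) \<and>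
       same_morphism (cosmash3 R M N N)
         (\<xi>N \<circ> cosmash3_incl_flat R M N N) (\<xi>MN \<circ> cosmash_incl_flat R M N \<circ> fold_MNN R M N) \<and>
       same_morphism (flat R K M)
         (\<xi>M \<circ> flat_map R K M MN M \<xi>\<xi> id) (\<xi>M \<circ> flat_map R K M MN M kk id) \<and>
       same_morphism (flat R K N)
         (\<xi>N \<circ> flat_map R K N MN N \<xi>\<xi> id) (\<xi>N \<circ> flat_map R K N MN N kk id))"


section \<open>Lie algebra actions\<close>

text \<open>\<open>act m n\<close> is the element written \<open>\<^sup>mn\<close>.\<close>

definition lie_action ::
  "('r, 'k) ring_scheme \<Rightarrow> ('r, 'm, 'x) module_scheme \<Rightarrow> ('r, 'n, 'y) module_scheme \<Rightarrow>
    ('m \<Rightarrow> 'n \<Rightarrow> 'n) \<Rightarrow> bool"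
  where "lie_action R M N act \<longleftrightarrow>
    (\<forall>m\<in>carrier M. \<forall>n\<in>carrier N. act m n \<in> carrier N) \<and>
    (\<forall>m\<in>carrier M. \<forall>m'\<in>carrier M. \<forall>n\<in>carrier N. act (m \<oplus>\<^bsub>M\<^esub> m') n = act m n \<oplus>\<^bsub>N\<^esub> act m' n) \<and>
    (\<forall>m\<in>carrier M. \<forall>n\<in>carrier N. \<forall>n'\<in>carrier N. act m (n \<oplus>\<^bsub>N\<^esub> n') = act m n \<oplus>\<^bsub>N\<^esub> act m n') \<and>
    (\<forall>a\<in>carrier R. \<forall>m\<in>carrier M. \<forall>n\<in>carrier N. act (a \<odot>\<^bsub>M\<^esub> m) n = a \<odot>\<^bsub>N\<^esub> act m n) \<and>
    (\<forall>a\<in>carrier R. \<forall>m\<in>carrier M. \<forall>n\<in>carrier N. act m (a \<odot>\<^bsub>N\<^esub> n) = a \<odot>\<^bsub>N\<^esub> act m n) \<and>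
    (\<forall>m\<in>carrier M. \<forall>m'\<in>carrier M. \<forall>n\<in>carrier N.
      act (m \<otimes>\<^bsub>M\<^esub> m') n = act m (act m' n) \<ominus>\<^bsub>N\<^esub> act m' (act m n)) \<and>
    (\<forall>m\<in>carrier M. \<forall>n\<in>carrier N. \<forall>n'\<in>carrier N.
      act m (n \<otimes>\<^bsub>N\<^esub> n') = act m n \<otimes>\<^bsub>N\<^esub> n' \<oplus>\<^bsub>N\<^esub> n \<otimes>\<^bsub>N\<^esub> act m n')"

text \<open>The semi-direct product \<open>N \<rtimes> M\<close>.\<close>

definition semidirect ::
  "('r, 'm, 'x) module_scheme \<Rightarrow> ('r, 'n, 'y) module_scheme \<Rightarrow> ('m \<Rightarrow> 'n \<Rightarrow> 'n) \<Rightarrow>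
    ('r, 'n \<times> 'm) module"
  where "semidirect M N act =
    (lie_product N M)\<lparr>mult := (\<lambda>(n, m) (n', m').
      (n \<otimes>\<^bsub>N\<^esub> n' \<oplus>\<^bsub>N\<^esub> (act m n' \<ominus>\<^bsub>N\<^esub> act m' n), m \<otimes>\<^bsub>M\<^esub> m'))\<rparr>"

text \<open>
  The morphism \<open>\<xi> : M \<flat> N \<rightarrow> N\<close> determined by \<open>k \<circ> \<xi> = \<langle>s, k\<rangle> \<circ> k\<^sub>M\<^sub>,\<^sub>N\<close>, where \<open>k n = (n, 0)\<close> and
  \<open>s m = (0, m)\<close> are the structure maps of \<open>N \<rtimes> M\<close>.
\<close>

definition corresponding_internal_action ::
  "('r, 'k) ring_scheme \<Rightarrow> ('r, 'm, 'x) module_scheme \<Rightarrow> ('r, 'n, 'y) module_scheme \<Rightarrow>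
    ('m \<Rightarrow> 'n \<Rightarrow> 'n) \<Rightarrow> ('r, 'm + 'n) lie_term set \<Rightarrow> 'n"
  where "corresponding_internal_action R M N act =
    (let k = (\<lambda>n. (n, \<zero>\<^bsub>M\<^esub>)); s = (\<lambda>m. (\<zero>\<^bsub>N\<^esub>, m)) in
      (\<lambda>x. THE n. n \<in> carrier N \<and>
        k n = copair (semidirect M N act) s k (flat_incl R M N x)))"

definition ellis_compatible ::
  "('r, 'm, 'x) module_scheme \<Rightarrow> ('r, 'n, 'y) module_scheme \<Rightarrow>
    ('m \<Rightarrow> 'n \<Rightarrow> 'n) \<Rightarrow> ('n \<Rightarrow> 'm \<Rightarrow> 'm) \<Rightarrow> bool"
  where "ellis_compatible M N actMN actNM \<longleftrightarrow>
    (\<forall>m\<in>carrier M. \<forall>m'\<in>carrier M. \<forall>n\<in>carrier N.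
      actNM (actMN m n) m' = m' \<otimes>\<^bsub>M\<^esub> actNM n m) \<and>
    (\<forall>m\<in>carrier M. \<forall>n\<in>carrier N. \<forall>n'\<in>carrier N.
      actMN (actNM n m) n' = n' \<otimes>\<^bsub>N\<^esub> actMN m n)"

end

theory Submission
  imports Defs
begin

text \<open>
  The associativity axiom of an internal action \<open>\<xi>\<close> of \<open>A\<close> on \<open>X\<close> gives \<open>\<xi> [a, y] = \<xi> [a, \<xi> y]\<close> for
  \<open>y \<in> A \<flat> X\<close>; as the ideal \<open>A \<flat> X\<close> of \<open>A + X\<close> is generated by \<open>X\<close>, the values \<open>\<xi> [a, x]\<close> determine
  \<open>\<xi>\<close>. If \<open>\<xi>\<^sub>M\<close> is an action of \<open>M + N\<close> on \<open>M\<close> as in (CA.0), then (CA.M) at \<open>[[m, n], m']\<close> with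
  \<open>[m, n] \<in> M \<flat> N\<close> compares \<open>\<xi>\<^sub>M [\<^sup>mn, m'] = act (act m n) m'\<close> with
  \<open>\<xi>\<^sub>M [[m, n], m'] = [m, \<^sup>nm'] - \<^sup>n[m, m'] = [m', \<^sup>nm]\<close>, which is the Ellis condition.

  Conversely, \<open>M + N\<close> acts on \<open>M\<close> through the canonical morphism \<open>\<phi> : M + N \<rightarrow> M \<rtimes> N\<close> and the bracket
  of \<open>M \<rtimes> N\<close>. The corresponding internal action is the restriction of \<open>\<langle>\<phi>, k\<rangle>\<close>, so (CA.0) is a matter
  of comparing morphisms on coproducts, and (CA.M) follows from the Ellis condition by induction over \<open>M \<flat> N\<close>.
\<close>

section \<open>Morphisms of Lie algebras\<close>

lemma lie_homI:
  assumes "\<And>x. x \<in> carrier A \<Longrightarrow> f x \<in> carrier B"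
    and "\<And>x y. \<lbrakk>x \<in> carrier A; y \<in> carrier A\<rbrakk> \<Longrightarrow> f (x \<oplus>\<^bsub>A\<^esub> y) = f x \<oplus>\<^bsub>B\<^esub> f y"
    and "\<And>a x. \<lbrakk>a \<in> carrier R; x \<in> carrier A\<rbrakk> \<Longrightarrow> f (a \<odot>\<^bsub>A\<^esub> x) = a \<odot>\<^bsub>B\<^esub> f x"
    and "\<And>x y. \<lbrakk>x \<in> carrier A; y \<in> carrier A\<rbrakk> \<Longrightarrow> f (x \<otimes>\<^bsub>A\<^esub> y) = f x \<otimes>\<^bsub>B\<^esub> f y"
  shows "f \<in> lie_hom R A B"
  using assms by (auto simp: lie_hom_def)

lemma lie_hom_closed: "\<lbrakk>f \<in> lie_hom R A B; x \<in> carrier A\<rbrakk> \<Longrightarrow> f x \<in> carrier B"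
  and lie_hom_add: "\<lbrakk>f \<in> lie_hom R A B; x \<in> carrier A; y \<in> carrier A\<rbrakk> \<Longrightarrow>
      f (x \<oplus>\<^bsub>A\<^esub> y) = f x \<oplus>\<^bsub>B\<^esub> f y"
  and lie_hom_smult: "\<lbrakk>f \<in> lie_hom R A B; a \<in> carrier R; x \<in> carrier A\<rbrakk> \<Longrightarrow>
      f (a \<odot>\<^bsub>A\<^esub> x) = a \<odot>\<^bsub>B\<^esub> f x"
  and lie_hom_bracket: "\<lbrakk>f \<in> lie_hom R A B; x \<in> carrier A; y \<in> carrier A\<rbrakk> \<Longrightarrow>
      f (x \<otimes>\<^bsub>A\<^esub> y) = f x \<otimes>\<^bsub>B\<^esub> f y"
  by (auto simp: lie_hom_def)

lemmas lie_hom_simps = lie_hom_closed lie_hom_add lie_hom_smult lie_hom_bracket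

text \<open>\<open>lie_hom\<close> asks only for compatibility with addition, scalars and bracket;
  zero is handled as the scalar multiple 0 * 0.\<close>

lemma lie_hom_zero:
  assumes A: "lie_algebra R A" and B: "lie_algebra R B" and f: "f \<in> lie_hom R A B"
  shows "f \<zero>\<^bsub>A\<^esub> = \<zero>\<^bsub>B\<^esub>"
proof -
  interpret A: lie_algebra R A by (rule A)
  interpret B: lie_algebra R B by (rule B)
  have "f (\<zero>\<^bsub>R\<^esub> \<odot>\<^bsub>A\<^esub> \<zero>\<^bsub>A\<^esub>) = \<zero>\<^bsub>R\<^esub> \<odot>\<^bsub>B\<^esub> f \<zero>\<^bsub>A\<^esub>"
    by (intro lie_hom_smult[OF f]) auto
  then show ?thesis using lie_hom_closed[OF f] by simp
qed

lemma lie_hom_a_inv: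
  assumes A: "lie_algebra R A" and B: "lie_algebra R B" and f: "f \<in> lie_hom R A B"
    and x: "x \<in> carrier A"
  shows "f (\<ominus>\<^bsub>A\<^esub> x) = \<ominus>\<^bsub>B\<^esub> f x"
proof -
  interpret A: lie_algebra R A by (rule A)
  interpret B: lie_algebra R B by (rule B)
  have "f (\<ominus>\<^bsub>A\<^esub> x) \<oplus>\<^bsub>B\<^esub> f x = \<zero>\<^bsub>B\<^esub>"
    using x lie_hom_add[OF f, of "\<ominus>\<^bsub>A\<^esub> x" x] lie_hom_zero[OF A B f] by (simp add: A.M.l_neg)
  then show ?thesis
    using x by (intro B.M.minus_equality[symmetric]) (auto intro: lie_hom_closed[OF f])
qed

lemma lie_hom_minus:
  assumes A: "lie_algebra R A" and B: "lie_algebra R B" and f: "f \<in> lie_hom R A B"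
    and x: "x \<in> carrier A" "y \<in> carrier A"
  shows "f (x \<ominus>\<^bsub>A\<^esub> y) = f x \<ominus>\<^bsub>B\<^esub> f y"
proof -
  interpret A: lie_algebra R A by (rule A)
  interpret B: lie_algebra R B by (rule B)
  show ?thesis
    using x by (simp add: A.M.minus_eq B.M.minus_eq lie_hom_add[OF f] lie_hom_a_inv[OF A B f])
qed

lemma lie_hom_id: "id \<in> lie_hom R A A"
  by (rule lie_homI) auto

lemma lie_hom_comp:
  "\<lbrakk>f \<in> lie_hom R A B; g \<in> lie_hom R B C\<rbrakk> \<Longrightarrow> g \<circ> f \<in> lie_hom R A C"
  by (rule lie_homI) (auto simp: lie_hom_simps)

section \<open>Identities for the bracket\<close>

context lie_algebra
begin

declare bracket_closed [simp, intro]

lemma minus_zero [simp]: "\<ominus>\<^bsub>L\<^esub> \<zero>\<^bsub>L\<^esub> = \<zero>\<^bsub>L\<^esub>"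
  by (rule M.minus_equality) auto

lemma bracket_zero_right [simp]:
  assumes x: "x \<in> carrier L" shows "x \<otimes>\<^bsub>L\<^esub> \<zero>\<^bsub>L\<^esub> = \<zero>\<^bsub>L\<^esub>"
  using bracket_smult_right[OF R.zero_closed x M.zero_closed] x by simp

lemma bracket_zero_left [simp]:
  assumes x: "x \<in> carrier L" shows "\<zero>\<^bsub>L\<^esub> \<otimes>\<^bsub>L\<^esub> x = \<zero>\<^bsub>L\<^esub>"
  using bracket_smult_left[OF R.zero_closed M.zero_closed x] x by simp

lemma bracket_minus_left:
  assumes x: "x \<in> carrier L" "y \<in> carrier L"
  shows "(\<ominus>\<^bsub>L\<^esub> x) \<otimes>\<^bsub>L\<^esub> y = \<ominus>\<^bsub>L\<^esub> (x \<otimes>\<^bsub>L\<^esub> y)"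
  using bracket_add_left[of "\<ominus>\<^bsub>L\<^esub> x" x y] x
  by (metis M.a_inv_closed M.l_neg M.minus_equality bracket_closed bracket_zero_left)

lemma bracket_minus_right:
  assumes x: "x \<in> carrier L" "y \<in> carrier L"
  shows "x \<otimes>\<^bsub>L\<^esub> (\<ominus>\<^bsub>L\<^esub> y) = \<ominus>\<^bsub>L\<^esub> (x \<otimes>\<^bsub>L\<^esub> y)"
  using bracket_add_right[of "\<ominus>\<^bsub>L\<^esub> y" y x] x
  by (metis M.a_inv_closed M.l_neg M.minus_equality bracket_closed bracket_zero_right)

lemma bracket_swap:
  assumes x: "x \<in> carrier L" "y \<in> carrier L"
  shows "x \<otimes>\<^bsub>L\<^esub> y = \<ominus>\<^bsub>L\<^esub> (y \<otimes>\<^bsub>L\<^esub> x)"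
proof -
  \<comment> \<open>Polarisation: in the expansion of [x + y, x + y] = 0 only the two mixed brackets
    survive.\<close>
  have "x \<otimes>\<^bsub>L\<^esub> y \<oplus>\<^bsub>L\<^esub> y \<otimes>\<^bsub>L\<^esub> x = (x \<oplus>\<^bsub>L\<^esub> y) \<otimes>\<^bsub>L\<^esub> (x \<oplus>\<^bsub>L\<^esub> y)"
    using x bracket_self[of x] bracket_self[of y]
    by (subst bracket_add_left) (simp_all add: bracket_add_right)
  also have "\<dots> = \<zero>\<^bsub>L\<^esub>"
    using x by (simp add: bracket_self)
  finally show ?thesis
    using x by (simp add: M.minus_equality)
qed

text \<open>The Jacobi identity solved for the left-nested bracket. In this form it parallels the
  axiom for the action of a bracket, which is how it serves in the \<open>bracket\<close> cases of
  \<open>ellis_flat_bracket\<close> and \<open>induced_action_agree\<close>.\<close>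

lemma bracket_bracket_left:
  assumes x: "x \<in> carrier L" "y \<in> carrier L" "z \<in> carrier L"
  shows "(x \<otimes>\<^bsub>L\<^esub> y) \<otimes>\<^bsub>L\<^esub> z = x \<otimes>\<^bsub>L\<^esub> (y \<otimes>\<^bsub>L\<^esub> z) \<ominus>\<^bsub>L\<^esub> y \<otimes>\<^bsub>L\<^esub> (x \<otimes>\<^bsub>L\<^esub> z)"
proof -
  have "y \<otimes>\<^bsub>L\<^esub> (z \<otimes>\<^bsub>L\<^esub> x) = \<ominus>\<^bsub>L\<^esub> (y \<otimes>\<^bsub>L\<^esub> (x \<otimes>\<^bsub>L\<^esub> z))"
    using x bracket_swap[of z x] by (simp add: bracket_minus_right)
  moreover have "z \<otimes>\<^bsub>L\<^esub> (x \<otimes>\<^bsub>L\<^esub> y) = \<ominus>\<^bsub>L\<^esub> ((x \<otimes>\<^bsub>L\<^esub> y) \<otimes>\<^bsub>L\<^esub> z)"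
    using x by (intro bracket_swap) auto
  ultimately have "(x \<otimes>\<^bsub>L\<^esub> (y \<otimes>\<^bsub>L\<^esub> z) \<ominus>\<^bsub>L\<^esub> y \<otimes>\<^bsub>L\<^esub> (x \<otimes>\<^bsub>L\<^esub> z)) \<ominus>\<^bsub>L\<^esub> (x \<otimes>\<^bsub>L\<^esub> y) \<otimes>\<^bsub>L\<^esub> z = \<zero>\<^bsub>L\<^esub>"
    using jacobi[of x y z] x by (simp add: M.minus_eq M.a_assoc)
  then show ?thesis
    using x M.minus_equality[of "x \<otimes>\<^bsub>L\<^esub> (y \<otimes>\<^bsub>L\<^esub> z) \<ominus>\<^bsub>L\<^esub> y \<otimes>\<^bsub>L\<^esub> (x \<otimes>\<^bsub>L\<^esub> z)"
      "\<ominus>\<^bsub>L\<^esub> ((x \<otimes>\<^bsub>L\<^esub> y) \<otimes>\<^bsub>L\<^esub> z)"] by (simp add: M.minus_eq)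
qed

end

section \<open>Zero morphisms and kernels\<close>

lemma zero_morphism_apply [simp]: "zero_morphism B x = \<zero>\<^bsub>B\<^esub>"
  by (simp add: zero_morphism_def)

lemma zero_morphism_hom:
  assumes "lie_algebra R B"
  shows "zero_morphism B \<in> lie_hom R A B"
proof -
  interpret B: lie_algebra R B by (rule assms)
  show ?thesis by (rule lie_homI) auto
qed

lemma lie_algebra_lie_kernel:
  assumes A: "lie_algebra R A" and B: "lie_algebra R B" and f: "f \<in> lie_hom R A B"
  shows "lie_algebra R (lie_kernel A B f)"
proof -
  interpret A: lie_algebra R A by (rule A)
  interpret B: lie_algebra R B by (rule B)
  note c = lie_kernel_def a_kernel_def'
  note z = lie_hom_zero[OF A B f]
  have ag: "abelian_group (lie_kernel A B f)"
  proof (rule abelian_groupI)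
    fix x assume x: "x \<in> carrier (lie_kernel A B f)"
    \<comment> \<open>The inverse is taken as a scalar multiple, so that it lies in the kernel by
      compatibility of \<open>f\<close> with scalars.\<close>
    let ?y = "(\<ominus>\<^bsub>R\<^esub> \<one>\<^bsub>R\<^esub>) \<odot>\<^bsub>A\<^esub> x"
    have "?y \<oplus>\<^bsub>A\<^esub> x = \<zero>\<^bsub>A\<^esub>"
      using x by (simp add: c A.smult_l_minus A.M.l_neg)
    then show "\<exists>y\<in>carrier (lie_kernel A B f). y \<oplus>\<^bsub>lie_kernel A B f\<^esub> x = \<zero>\<^bsub>lie_kernel A B f\<^esub>"
      using x lie_hom_smult[OF f] by (intro bexI[of _ ?y]) (auto simp: c)
  qed (auto simp: c z lie_hom_simps[OF f] A.M.a_ac)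
  have "module R (lie_kernel A B f)"
    by (rule moduleI[OF A.R.cring_axioms ag])
      (auto simp: c lie_hom_simps[OF f] A.smult_l_distr A.smult_r_distr A.smult_assoc1)
  then show ?thesis
    unfolding lie_algebra_def lie_algebra_axioms_def
    by (auto simp: c lie_hom_simps[OF f] A.bracket_add_left A.bracket_add_right
        A.bracket_smult_left A.bracket_smult_right A.bracket_self A.jacobi)
qed

section \<open>Coproducts and the functor \<open>\<flat>\<close>\<close>

text \<open>Elements are classes of terms, so this is induction on terms. The term
  \<open>Zero\<close> gets no case of its own: its class is the image of the zero of
  \<open>A\<close> and falls under \<open>inl\<close>.\<close>

lemma coproduct_induct [consumes 3, case_names inl inr add smult bracket]:
  assumes A: "lie_algebra R A" and B: "lie_algebra R B"
    and w: "w \<in> carrier (coproduct R A B)"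
    and inl: "\<And>a. a \<in> carrier A \<Longrightarrow> P (coprod_inl R A B a)"
    and inr: "\<And>b. b \<in> carrier B \<Longrightarrow> P (coprod_inr R A B b)"
    and add: "\<And>u v. \<lbrakk>u \<in> carrier (coproduct R A B); v \<in> carrier (coproduct R A B); P u; P v\<rbrakk> \<Longrightarrow>
      P (u \<oplus>\<^bsub>coproduct R A B\<^esub> v)"
    and smult: "\<And>r u. \<lbrakk>r \<in> carrier R; u \<in> carrier (coproduct R A B); P u\<rbrakk> \<Longrightarrow>
      P (r \<odot>\<^bsub>coproduct R A B\<^esub> u)"
    and bracket: "\<And>u v. \<lbrakk>u \<in> carrier (coproduct R A B); v \<in> carrier (coproduct R A B); P u; P v\<rbrakk> \<Longrightarrow>
      P (u \<otimes>\<^bsub>coproduct R A B\<^esub> v)"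
  shows "P w"
proof -
  interpret A: lie_algebra R A by (rule A)
  note AB = A B
  have "P (lie_cong R A B `` {t})" if "t \<in> lie_terms R A B" for t
    using that
  proof (induction t)
    case (Gen x)
    then show ?case using inl inr
      by (cases x) (auto simp: coprod_inl_def coprod_inr_def lie_terms_simps[OF AB])
  next
    case Zero
    have "\<zero>\<^bsub>coproduct R A B\<^esub> = coprod_inl R A B \<zero>\<^bsub>A\<^esub>"
      by (rule lie_hom_zero[OF A lie_algebra_coproduct[OF AB] coprod_inl_hom[OF AB], symmetric])
    then show ?case using inl[OF A.M.zero_closed] by (simp add: coproduct_zero[OF AB])
  next
    case (Add s t)
    then show ?case
      using add[of "lie_cong R A B `` {s}" "lie_cong R A B `` {t}"]
      by (auto simp: coproduct_simps[OF AB] lie_terms_simps[OF AB])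
  next
    case (Smult r t)
    then show ?case
      using smult[of r "lie_cong R A B `` {t}"]
      by (auto simp: coproduct_simps[OF AB] lie_terms_simps[OF AB])
  next
    case (Bracket s t)
    then show ?case
      using bracket[of "lie_cong R A B `` {s}" "lie_cong R A B `` {t}"]
      by (auto simp: coproduct_simps[OF AB] lie_terms_simps[OF AB])
  qed
  then show ?thesis using w by (auto simp: coproduct_carrier[OF AB])
qed

lemma copair_inl_apply:
  assumes "lie_algebra R A" "lie_algebra R B" "lie_algebra R C" "f \<in> lie_hom R A C" "g \<in> lie_hom R B C"
    and "a \<in> carrier A"
  shows "copair C f g (coprod_inl R A B a) = f a"
  using copair_inl[OF assms(1-5)] assms(6) by (simp add: same_morphism_def)

lemma copair_inr_apply:
  assumes "lie_algebra R A" "lie_algebra R B" "lie_algebra R C" "f \<in> lie_hom R A C" "g \<in> lie_hom R B C"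
    and "b \<in> carrier B"
  shows "copair C f g (coprod_inr R A B b) = g b"
  using copair_inr[OF assms(1-5)] assms(6) by (simp add: same_morphism_def)

text \<open>Uniqueness in the universal property, stated for two arbitrary morphisms. Equations
  between composites are reduced by it to their values on the two summands.\<close>

lemma coproduct_hom_eqI:
  assumes AB: "lie_algebra R A" "lie_algebra R B"
    and f: "f \<in> lie_hom R (coproduct R A B) C" and g: "g \<in> lie_hom R (coproduct R A B) C"
    and "\<And>a. a \<in> carrier A \<Longrightarrow> f (coprod_inl R A B a) = g (coprod_inl R A B a)"
    and "\<And>b. b \<in> carrier B \<Longrightarrow> f (coprod_inr R A B b) = g (coprod_inr R A B b)"
    and w: "w \<in> carrier (coproduct R A B)"
  shows "f w = g w"
  using AB w assms(5,6)
  by (induction rule: coproduct_induct) (simp_all add: lie_hom_simps[OF f] lie_hom_simps[OF g])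

lemma coprod_map_hom:
  assumes "lie_algebra R A" "lie_algebra R B" "lie_algebra R A'" "lie_algebra R B'"
    and "f \<in> lie_hom R A A'" "g \<in> lie_hom R B B'"
  shows "coprod_map R A' B' f g \<in> lie_hom R (coproduct R A B) (coproduct R A' B')"
  unfolding coprod_map_def
  by (intro copair_hom lie_algebra_coproduct assms
      lie_hom_comp[OF assms(5) coprod_inl_hom] lie_hom_comp[OF assms(6) coprod_inr_hom])

lemma
  assumes "lie_algebra R A" "lie_algebra R B" "lie_algebra R A'" "lie_algebra R B'"
    and "f \<in> lie_hom R A A'" "g \<in> lie_hom R B B'"
  shows coprod_map_inl: "a \<in> carrier A \<Longrightarrow>
      coprod_map R A' B' f g (coprod_inl R A B a) = coprod_inl R A' B' (f a)"
    and coprod_map_inr: "b \<in> carrier B \<Longrightarrow>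
      coprod_map R A' B' f g (coprod_inr R A B b) = coprod_inr R A' B' (g b)"
  using copair_inl_apply[OF assms(1,2) lie_algebra_coproduct[OF assms(3,4)]
      lie_hom_comp[OF assms(5) coprod_inl_hom[OF assms(3,4)]]
      lie_hom_comp[OF assms(6) coprod_inr_hom[OF assms(3,4)]]]
    copair_inr_apply[OF assms(1,2) lie_algebra_coproduct[OF assms(3,4)]
      lie_hom_comp[OF assms(5) coprod_inl_hom[OF assms(3,4)]]
      lie_hom_comp[OF assms(6) coprod_inr_hom[OF assms(3,4)]]]
  by (simp_all add: coprod_map_def)

lemma flat_ops [simp]:
  "x \<oplus>\<^bsub>flat R A B\<^esub> y = x \<oplus>\<^bsub>coproduct R A B\<^esub> y"
  "x \<otimes>\<^bsub>flat R A B\<^esub> y = x \<otimes>\<^bsub>coproduct R A B\<^esub> y"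
  "r \<odot>\<^bsub>flat R A B\<^esub> y = r \<odot>\<^bsub>coproduct R A B\<^esub> y"
  "\<zero>\<^bsub>flat R A B\<^esub> = \<zero>\<^bsub>coproduct R A B\<^esub>"
  by (simp_all add: flat_def lie_kernel_def)

lemma flat_carrier:
  "x \<in> carrier (flat R A B) \<longleftrightarrow>
    x \<in> carrier (coproduct R A B) \<and> copair A id (zero_morphism A) x = \<zero>\<^bsub>A\<^esub>"
  by (simp add: flat_def lie_kernel_def a_kernel_def')

lemma flat_incl_apply [simp]: "x \<in> carrier (flat R A B) \<Longrightarrow> flat_incl R A B x = x"
  by (simp add: flat_incl_def)

lemma flat_map_apply:
  "x \<in> carrier (flat R A B) \<Longrightarrow> flat_map R A B A' B' f g x = coprod_map R A' B' f g x"
  by (simp add: flat_map_def)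

context
  fixes R :: "('r, 'k) ring_scheme"
    and A :: "('r, 'a, 'x) module_scheme" and X :: "('r, 'b, 'y) module_scheme"
  assumes A: "lie_algebra R A" and X: "lie_algebra R X"
begin

interpretation A: lie_algebra R A by (rule A)
interpretation X: lie_algebra R X by (rule X)
interpretation AX: lie_algebra R "coproduct R A X" by (rule lie_algebra_coproduct[OF A X])

private abbreviation (input) "inl \<equiv> coprod_inl R A X"
private abbreviation (input) "inr \<equiv> coprod_inr R A X"
private abbreviation (input) "p \<equiv> copair A id (zero_morphism A)"

private lemma p_hom: "p \<in> lie_hom R (coproduct R A X) A"
  by (intro copair_hom A X lie_hom_id zero_morphism_hom)

private lemma p_inl: "a \<in> carrier A \<Longrightarrow> p (inl a) = a"
  by (simp add: copair_inl_apply[OF A X A lie_hom_id zero_morphism_hom[OF A]])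

private lemma p_inr: "x \<in> carrier X \<Longrightarrow> p (inr x) = \<zero>\<^bsub>A\<^esub>"
  by (simp add: copair_inr_apply[OF A X A lie_hom_id zero_morphism_hom[OF A]])

lemma lie_algebra_flat: "lie_algebra R (flat R A X)"
  unfolding flat_def by (intro lie_algebra_lie_kernel lie_algebra_coproduct A X p_hom)

lemma coprod_inl_closed: "a \<in> carrier A \<Longrightarrow> inl a \<in> carrier (coproduct R A X)"
  and coprod_inr_closed: "x \<in> carrier X \<Longrightarrow> inr x \<in> carrier (coproduct R A X)"
  using coprod_inl_hom[OF A X] coprod_inr_hom[OF A X] by (auto simp: lie_hom_closed)

lemma flat_subset: "y \<in> carrier (flat R A X) \<Longrightarrow> y \<in> carrier (coproduct R A X)"
  by (simp add: flat_carrier)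

lemma coprod_inr_flat: "x \<in> carrier X \<Longrightarrow> inr x \<in> carrier (flat R A X)"
  by (simp add: flat_carrier p_inr coprod_inr_closed)

lemma flat_bracket_inl:
  "\<lbrakk>a \<in> carrier A; y \<in> carrier (flat R A X)\<rbrakk> \<Longrightarrow>
    inl a \<otimes>\<^bsub>coproduct R A X\<^esub> y \<in> carrier (flat R A X)"
  by (simp add: flat_carrier lie_hom_simps[OF p_hom] coprod_inl_closed p_inl)

lemma flat_bracket_inr:
  "\<lbrakk>a \<in> carrier A; x \<in> carrier X\<rbrakk> \<Longrightarrow>
    inl a \<otimes>\<^bsub>coproduct R A X\<^esub> inr x \<in> carrier (flat R A X)"
  by (simp add: flat_bracket_inl coprod_inr_flat)

lemma flat_incl_hom: "flat_incl R A X \<in> lie_hom R (flat R A X) (coproduct R A X)"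
  using lie_algebra_flat unfolding lie_hom_def flat_incl_def
  by (auto simp: flat_carrier lie_hom_simps[OF p_hom])

text \<open>Additive inverses are defined relative to a carrier, so subtraction, unlike the
  operations in \<open>flat_ops\<close>, does not agree by unfolding; the inclusion morphism
  transports it.\<close>

lemma flat_minus:
  assumes "u \<in> carrier (flat R A X)" "v \<in> carrier (flat R A X)"
  shows "u \<ominus>\<^bsub>flat R A X\<^esub> v = u \<ominus>\<^bsub>coproduct R A X\<^esub> v"
  using assms lie_hom_minus[OF lie_algebra_flat AX.lie_algebra_axioms flat_incl_hom assms]
    abelian_group.minus_closed[OF module.axioms(2)[OF lie_algebra.axioms(1)[OF lie_algebra_flat]]]
  by simp

text \<open>
  As an ideal of \<open>A + X\<close>, the kernel \<open>A \<flat> X\<close> is generated by \<open>X\<close>: the sums of an element satisfying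
  \<open>P\<close> and an element of \<open>A\<close> form a subalgebra.
\<close>

lemma flat_induct [consumes 3, case_names inr inl_bracket add smult bracket]:
  assumes y: "y \<in> carrier (flat R A X)"
    and inr: "\<And>x. x \<in> carrier X \<Longrightarrow> P (inr x)"
    and inl: "\<And>a y. \<lbrakk>a \<in> carrier A; y \<in> carrier (flat R A X); P y\<rbrakk> \<Longrightarrow>
      P (inl a \<otimes>\<^bsub>coproduct R A X\<^esub> y)"
    and add: "\<And>u v. \<lbrakk>u \<in> carrier (flat R A X); v \<in> carrier (flat R A X); P u; P v\<rbrakk> \<Longrightarrow>
      P (u \<oplus>\<^bsub>coproduct R A X\<^esub> v)"
    and smult: "\<And>r u. \<lbrakk>r \<in> carrier R; u \<in> carrier (flat R A X); P u\<rbrakk> \<Longrightarrow>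
      P (r \<odot>\<^bsub>coproduct R A X\<^esub> u)"
    and bracket: "\<And>u v. \<lbrakk>u \<in> carrier (flat R A X); v \<in> carrier (flat R A X); P u; P v\<rbrakk> \<Longrightarrow>
      P (u \<otimes>\<^bsub>coproduct R A X\<^esub> v)"
  shows "P y"
proof -
  note i = lie_hom_simps[OF coprod_inl_hom[OF A X]]
  interpret F: lie_algebra R "flat R A X" by (rule lie_algebra_flat)
  let ?S = "{u \<in> carrier (flat R A X). P u}"
  let ?Q = "\<lambda>w. \<exists>u\<in>?S. \<exists>a\<in>carrier A. w = u \<oplus>\<^bsub>coproduct R A X\<^esub> inl a"
  have z: "\<zero>\<^bsub>coproduct R A X\<^esub> \<in> ?S"
    using inr[OF X.M.zero_closed] lie_hom_zero[OF X lie_algebra_coproduct[OF A X] coprod_inr_hom[OF A X]]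
      F.M.zero_closed by simp
  have iz: "inl \<zero>\<^bsub>A\<^esub> = \<zero>\<^bsub>coproduct R A X\<^esub>"
    by (rule lie_hom_zero[OF A lie_algebra_coproduct[OF A X] coprod_inl_hom[OF A X]])
  have S_add: "u \<oplus>\<^bsub>coproduct R A X\<^esub> v \<in> ?S" if "u \<in> ?S" "v \<in> ?S" for u v
    using that add F.M.add.m_closed by simp
  have S_smult: "r \<odot>\<^bsub>coproduct R A X\<^esub> u \<in> ?S" if "r \<in> carrier R" "u \<in> ?S" for u r
    using that smult F.smult_closed by simp
  have S_bracket: "u \<otimes>\<^bsub>coproduct R A X\<^esub> v \<in> ?S" if "u \<in> ?S" "v \<in> ?S" for u v
    using that bracket F.bracket_closed by simp
  have S_inl: "inl a \<otimes>\<^bsub>coproduct R A X\<^esub> v \<in> ?S" if "a \<in> carrier A" "v \<in> ?S" for a v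
    using that inl flat_bracket_inl by simp
  \<comment> \<open>The hypotheses bracket with \<open>A\<close> only from the left; antisymmetry
    and the scalar -1 supply the other side.\<close>
  have S_inl': "v \<otimes>\<^bsub>coproduct R A X\<^esub> inl a \<in> ?S" if "a \<in> carrier A" "v \<in> ?S" for a v
  proof -
    have "v \<otimes>\<^bsub>coproduct R A X\<^esub> inl a =
        (\<ominus>\<^bsub>R\<^esub> \<one>\<^bsub>R\<^esub>) \<odot>\<^bsub>coproduct R A X\<^esub> (inl a \<otimes>\<^bsub>coproduct R A X\<^esub> v)"
      using that AX.bracket_swap[of v "inl a"] by (simp add: AX.smult_l_minus coprod_inl_closed flat_subset)
    then show ?thesis using that S_inl[of a v] S_smult by auto
  qed
  have "y \<in> carrier (coproduct R A X)" using y by (simp add: flat_carrier)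
  with A X have "?Q y"
  proof (induction rule: coproduct_induct)
    case (inl a)
    then show ?case using z by (intro bexI[of _ "\<zero>\<^bsub>coproduct R A X\<^esub>"] bexI[of _ a]) (auto simp: coprod_inl_closed)
  next
    case (inr x)
    then show ?case using assms(2)
      by (intro bexI[of _ "inr x"] bexI[of _ "\<zero>\<^bsub>A\<^esub>"]) (auto simp: iz coprod_inr_closed coprod_inr_flat)
  next
    case (add w w')
    then obtain u a u' a' where *: "u \<in> ?S" "a \<in> carrier A" "w = u \<oplus>\<^bsub>coproduct R A X\<^esub> inl a"
      "u' \<in> ?S" "a' \<in> carrier A" "w' = u' \<oplus>\<^bsub>coproduct R A X\<^esub> inl a'" by blast
    then have "w \<oplus>\<^bsub>coproduct R A X\<^esub> w' = (u \<oplus>\<^bsub>coproduct R A X\<^esub> u') \<oplus>\<^bsub>coproduct R A X\<^esub> inl (a \<oplus>\<^bsub>A\<^esub> a')"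
      by (simp add: i AX.M.a_ac flat_subset)
    with * S_add A.M.add.m_closed show ?case by blast
  next
    case (smult r w)
    then obtain u a where *: "u \<in> ?S" "a \<in> carrier A" "w = u \<oplus>\<^bsub>coproduct R A X\<^esub> inl a" by blast
    then have "r \<odot>\<^bsub>coproduct R A X\<^esub> w = r \<odot>\<^bsub>coproduct R A X\<^esub> u \<oplus>\<^bsub>coproduct R A X\<^esub> inl (r \<odot>\<^bsub>A\<^esub> a)"
      using smult by (simp add: i flat_subset AX.smult_r_distr)
    with * smult S_smult A.smult_closed show ?case by blast
  next
    case (bracket w w')
    then obtain u a u' a' where *: "u \<in> ?S" "a \<in> carrier A" "w = u \<oplus>\<^bsub>coproduct R A X\<^esub> inl a"
      "u' \<in> ?S" "a' \<in> carrier A" "w' = u' \<oplus>\<^bsub>coproduct R A X\<^esub> inl a'" by blast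
    \<comment> \<open>Of the four terms of the product, the three that involve u or u' stay in
      \<open>?S\<close>; only [a, a'] remains in \<open>A\<close>.\<close>
    then have "w \<otimes>\<^bsub>coproduct R A X\<^esub> w' =
        (u \<otimes>\<^bsub>coproduct R A X\<^esub> u' \<oplus>\<^bsub>coproduct R A X\<^esub>
          (inl a \<otimes>\<^bsub>coproduct R A X\<^esub> u' \<oplus>\<^bsub>coproduct R A X\<^esub> u \<otimes>\<^bsub>coproduct R A X\<^esub> inl a'))
        \<oplus>\<^bsub>coproduct R A X\<^esub> inl (a \<otimes>\<^bsub>A\<^esub> a')"
      by (simp add: i AX.M.a_ac flat_subset AX.bracket_add_left AX.bracket_add_right)
    then show ?case
      using * by (intro bexI[of _ "u \<otimes>\<^bsub>coproduct R A X\<^esub> u' \<oplus>\<^bsub>coproduct R A X\<^esub>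
          (inl a \<otimes>\<^bsub>coproduct R A X\<^esub> u' \<oplus>\<^bsub>coproduct R A X\<^esub> u \<otimes>\<^bsub>coproduct R A X\<^esub> inl a')"]
          bexI[of _ "a \<otimes>\<^bsub>A\<^esub> a'"] S_add S_bracket S_inl S_inl' A.bracket_closed)
  qed
  then obtain u a where u: "u \<in> ?S" "a \<in> carrier A" "y = u \<oplus>\<^bsub>coproduct R A X\<^esub> inl a" by blast
  \<comment> \<open>The projection to \<open>A\<close> vanishes on y and on u, so it leaves only
    a.\<close>
  then have "a = \<zero>\<^bsub>A\<^esub>"
    using y by (simp add: flat_carrier lie_hom_simps[OF p_hom] p_inl coprod_inl_closed)
  then have "y = u" using u by (simp add: iz flat_subset)
  then show ?thesis using u by simp
qed

end

text \<open>The projection to \<open>A'\<close> after f + g equals f after the projection to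
  \<open>A\<close>, as seen on both summands. Hence f + g maps kernel into kernel, and its
  restriction inherits compatibility with the operations.\<close>

lemma flat_map_hom:
  assumes A: "lie_algebra R A" "lie_algebra R B" "lie_algebra R A'" "lie_algebra R B'"
    and f: "f \<in> lie_hom R A A'" and g: "g \<in> lie_hom R B B'"
  shows "flat_map R A B A' B' f g \<in> lie_hom R (flat R A B) (flat R A' B')"
proof -
  interpret F: lie_algebra R "flat R A B" by (rule lie_algebra_flat[OF A(1,2)])
  note h = coprod_map_hom[OF A f g]
  have k: "copair A' id (zero_morphism A') \<in> lie_hom R (coproduct R A' B') A'"
    by (intro copair_hom A lie_hom_id zero_morphism_hom)
  have k': "copair A id (zero_morphism A) \<in> lie_hom R (coproduct R A B) A"
    by (intro copair_hom A lie_hom_id zero_morphism_hom)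
  have "(copair A' id (zero_morphism A') \<circ> coprod_map R A' B' f g) x =
      (f \<circ> copair A id (zero_morphism A)) x"
    if "x \<in> carrier (coproduct R A B)" for x
    by (rule coproduct_hom_eqI[OF A(1,2) lie_hom_comp[OF h k] lie_hom_comp[OF k' f] _ _ that])
      (simp_all add: coprod_map_inl[OF A f g] coprod_map_inr[OF A f g]
        copair_inl_apply[OF A(3,4,3) lie_hom_id zero_morphism_hom[OF A(3)]]
        copair_inl_apply[OF A(1,2,1) lie_hom_id zero_morphism_hom[OF A(1)]]
        copair_inr_apply[OF A(3,4,3) lie_hom_id zero_morphism_hom[OF A(3)]]
        copair_inr_apply[OF A(1,2,1) lie_hom_id zero_morphism_hom[OF A(1)]]
        lie_hom_closed[OF f] lie_hom_closed[OF g] lie_hom_zero[OF A(1,3) f]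
        )
  then have "flat_map R A B A' B' f g x \<in> carrier (flat R A' B')" if "x \<in> carrier (flat R A B)" for x
    using that by (simp add: flat_map_apply flat_carrier lie_hom_closed[OF h] lie_hom_zero[OF A(1,3) f])
  then show ?thesis
    using lie_hom_simps[OF h] F.M.add.m_closed F.smult_closed F.bracket_closed
    by (intro lie_homI) (simp_all add: flat_map_apply flat_subset[OF A(1,2)])
qed

section \<open>Internal actions\<close>

context
  fixes R :: "('r, 'k) ring_scheme"
    and A :: "('r, 'a, 'x) module_scheme" and X :: "('r, 'b, 'y) module_scheme"
  assumes A: "lie_algebra R A" and X: "lie_algebra R X"
begin

interpretation X: lie_algebra R X by (rule X)
interpretation AX: lie_algebra R "coproduct R A X" by (rule lie_algebra_coproduct[OF A X])
interpretation F: lie_algebra R "flat R A X" by (rule lie_algebra_flat[OF A X])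

lemma internal_action_inr:
  "\<lbrakk>internal_action R A X \<xi>; x \<in> carrier X\<rbrakk> \<Longrightarrow> \<xi> (coprod_inr R A X x) = x"
  by (simp add: internal_action_def same_morphism_def flat_unit_def)

text \<open>The associativity axiom, evaluated at the element \<open>[a, y]\<close> of \<open>A \<flat> (A \<flat> X)\<close>.\<close>

lemma internal_action_inl_bracket:
  assumes act: "internal_action R A X \<xi>" and a: "a \<in> carrier A" and y: "y \<in> carrier (flat R A X)"
  shows "\<xi> (coprod_inl R A X a \<otimes>\<^bsub>coproduct R A X\<^esub> y) =
    \<xi> (coprod_inl R A X a \<otimes>\<^bsub>coproduct R A X\<^esub> coprod_inr R A X (\<xi> y))"
proof -
  let ?F = "flat R A X"
  note F = F.lie_algebra_axioms
  note AF = lie_algebra_coproduct[OF A F]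
  have xi: "\<xi> \<in> lie_hom R ?F X" using act by (simp add: internal_action_def)
  let ?w = "coprod_inl R A ?F a \<otimes>\<^bsub>coproduct R A ?F\<^esub> coprod_inr R A ?F y"
  have w: "?w \<in> carrier (flat R A ?F)" by (rule flat_bracket_inr[OF A F a y])
  note m = AX.lie_algebra_axioms coprod_inl_hom[OF A X] flat_incl_hom[OF A X]
  have "flat_mult R A X ?w = coprod_inl R A X a \<otimes>\<^bsub>coproduct R A X\<^esub> y"
    using a y w by (simp add: flat_mult_def lie_hom_bracket[OF copair_hom[OF A F m]]
        coprod_inl_closed[OF A F] coprod_inr_closed[OF A F]
        copair_inl_apply[OF A F m] copair_inr_apply[OF A F m])
  moreover have "flat_map R A ?F A X id \<xi> ?w =
      coprod_inl R A X a \<otimes>\<^bsub>coproduct R A X\<^esub> coprod_inr R A X (\<xi> y)"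
    using a y w by (simp add: flat_map_apply lie_hom_bracket[OF coprod_map_hom[OF A F A X lie_hom_id xi]]
        coprod_inl_closed[OF A F] coprod_inr_closed[OF A F]
        coprod_map_inl[OF A F A X lie_hom_id xi] coprod_map_inr[OF A F A X lie_hom_id xi])
  ultimately show ?thesis
    using act w by (auto simp: internal_action_def same_morphism_def)
qed

text \<open>Reduces (CA.M) and (CA.N) to elements [p, x] with p in the acting algebra and x in
  \<open>X\<close>. Both composites are the identity on \<open>X\<close>, and by
  \<open>internal_action_inl_bracket\<close> their value at [b, y] depends on y only through its
  image in \<open>X\<close>; \<open>flat_induct\<close> does the rest.\<close>

lemma internal_action_flat_map_agree:
  assumes act: "internal_action R A X \<xi>" and B: "lie_algebra R B"
    and f: "f \<in> lie_hom R B A" and g: "g \<in> lie_hom R B A"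
    and agree: "\<And>b x. \<lbrakk>b \<in> carrier B; x \<in> carrier X\<rbrakk> \<Longrightarrow>
      \<xi> (coprod_inl R A X (f b) \<otimes>\<^bsub>coproduct R A X\<^esub> coprod_inr R A X x) =
      \<xi> (coprod_inl R A X (g b) \<otimes>\<^bsub>coproduct R A X\<^esub> coprod_inr R A X x)"
  shows "same_morphism (flat R B X) (\<xi> \<circ> flat_map R B X A X f id) (\<xi> \<circ> flat_map R B X A X g id)"
proof -
  have xi: "\<xi> \<in> lie_hom R (flat R A X) X" using act by (simp add: internal_action_def)
  let ?z = "\<lambda>h. \<xi> \<circ> flat_map R B X A X h id"
  have fm: "flat_map R B X A X h id \<in> lie_hom R (flat R B X) (flat R A X)"
    if "h \<in> lie_hom R B A" for h
    by (rule flat_map_hom[OF B X A X that lie_hom_id])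
  have hom: "?z h \<in> lie_hom R (flat R B X) X" if "h \<in> lie_hom R B A" for h
    by (rule lie_hom_comp[OF fm[OF that] xi])
  have z_inr: "?z h (coprod_inr R B X x) = x" if "h \<in> lie_hom R B A" "x \<in> carrier X" for h x
    using that by (simp add: flat_map_apply coprod_inr_flat[OF B X] internal_action_inr[OF act]
        coprod_map_inr[OF B X A X that(1) lie_hom_id])
  have z_inl: "?z h (coprod_inl R B X b \<otimes>\<^bsub>coproduct R B X\<^esub> y) =
      \<xi> (coprod_inl R A X (h b) \<otimes>\<^bsub>coproduct R A X\<^esub> coprod_inr R A X (?z h y))"
    if h: "h \<in> lie_hom R B A" and b: "b \<in> carrier B" and y: "y \<in> carrier (flat R B X)" for h b y
  proof -
    have "?z h (coprod_inl R B X b \<otimes>\<^bsub>coproduct R B X\<^esub> y) =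
        \<xi> (coprod_inl R A X (h b) \<otimes>\<^bsub>coproduct R A X\<^esub> flat_map R B X A X h id y)"
      using b y by (simp add: flat_map_apply flat_bracket_inl[OF B X] flat_subset[OF B X] coprod_inl_closed[OF B X]
          lie_hom_bracket[OF coprod_map_hom[OF B X A X h lie_hom_id]] coprod_map_inl[OF B X A X h lie_hom_id])
    then show ?thesis
      using internal_action_inl_bracket[OF act lie_hom_closed[OF h b] lie_hom_closed[OF fm[OF h] y]]
      by simp
  qed
  have "?z f y = ?z g y" if "y \<in> carrier (flat R B X)" for y
    using B X that
  proof (induction rule: flat_induct)
    case (inr x)
    then show ?case by (simp only: z_inr[OF f] z_inr[OF g])
  next
    case (inl_bracket b y)
    then show ?case
      by (simp only: z_inl[OF f] z_inl[OF g] agree lie_hom_closed[OF hom[OF g]])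
  next
    case (add u v)
    then show ?case using lie_hom_add[OF hom[OF f]] lie_hom_add[OF hom[OF g]] by (simp add: id_def)
  next
    case (smult r u)
    then show ?case using lie_hom_smult[OF hom[OF f]] lie_hom_smult[OF hom[OF g]] by (simp add: id_def)
  next
    case (bracket u v)
    then show ?case using lie_hom_bracket[OF hom[OF f]] lie_hom_bracket[OF hom[OF g]] by (simp add: id_def)
  qed
  then show ?thesis by (simp add: same_morphism_def)
qed

text \<open>After composition with the injective k, the axioms become equations for the restriction
  of the morphism induced by s and k, and these can be checked on coproducts. Injectivity brings
  them back to \<xi>.\<close>

lemma internal_actionI_embedding:
  assumes E: "lie_algebra R E" and s: "s \<in> lie_hom R A E" and k: "k \<in> lie_hom R X E"
    and inj: "inj_on k (carrier X)"
    and closed: "\<And>y. y \<in> carrier (flat R A X) \<Longrightarrow> \<xi> y \<in> carrier X"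
    and xi: "\<And>y. y \<in> carrier (flat R A X) \<Longrightarrow> k (\<xi> y) = copair E s k y"
  shows "internal_action R A X \<xi>"
proof -
  note F = F.lie_algebra_axioms
  note sk = copair_hom[OF A X E s k]
  have eqI: "u = v" if "k u = k v" "u \<in> carrier X" "v \<in> carrier X" for u v
    using inj that by (auto simp: inj_on_def)
  have hom: "\<xi> \<in> lie_hom R (flat R A X) X"
  proof (rule lie_homI)
    fix u v assume uv: "u \<in> carrier (flat R A X)" "v \<in> carrier (flat R A X)"
    then show "\<xi> (u \<oplus>\<^bsub>flat R A X\<^esub> v) = \<xi> u \<oplus>\<^bsub>X\<^esub> \<xi> v" "\<xi> (u \<otimes>\<^bsub>flat R A X\<^esub> v) = \<xi> u \<otimes>\<^bsub>X\<^esub> \<xi> v"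
      using xi[OF F.M.add.m_closed] closed[OF F.M.add.m_closed] closed[OF F.bracket_closed] xi[OF F.bracket_closed]
      by (auto intro!: eqI simp: closed xi lie_hom_simps[OF k] lie_hom_simps[OF sk] flat_subset[OF A X])
  next
    fix r u assume "r \<in> carrier R" "u \<in> carrier (flat R A X)"
    then show "\<xi> (r \<odot>\<^bsub>flat R A X\<^esub> u) = r \<odot>\<^bsub>X\<^esub> \<xi> u"
      using xi[OF F.smult_closed] closed[OF F.smult_closed]
      by (auto intro!: eqI simp: closed xi lie_hom_simps[OF k] lie_hom_simps[OF sk] flat_subset[OF A X])
  qed (rule closed)
  have unit: "\<xi> (coprod_inr R A X x) = x" if x: "x \<in> carrier X" for x
    by (rule eqI) (simp_all add: x closed xi coprod_inr_flat[OF A X] copair_inr_apply[OF A X E s k])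
  have mult: "\<xi> (flat_mult R A X w) = \<xi> (flat_map R A (flat R A X) A X id \<xi> w)"
    if w: "w \<in> carrier (flat R A (flat R A X))" for w
  proof -
    note m = AX.lie_algebra_axioms coprod_inl_hom[OF A X] flat_incl_hom[OF A X]
    note mh = copair_hom[OF A F m]
    note c = coprod_map_hom[OF A F A X lie_hom_id hom]
    have w': "w \<in> carrier (coproduct R A (flat R A X))" using w by (rule flat_subset[OF A F])
    \<comment> \<open>On \<open>A\<close> both sides are s. On \<open>flat R A X\<close> the left
      one is the morphism induced by s and k, the right one is k after \<xi>, and these agree by
      assumption.\<close>
    have eq: "(copair E s k \<circ> copair (coproduct R A X) (coprod_inl R A X) (flat_incl R A X)) w =
        (copair E s k \<circ> coprod_map R A X id \<xi>) w"
      by (rule coproduct_hom_eqI[OF A F lie_hom_comp[OF mh sk] lie_hom_comp[OF c sk] _ _ w'])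
        (simp_all add: copair_inl_apply[OF A F m] copair_inr_apply[OF A F m]
          coprod_map_inl[OF A F A X lie_hom_id hom] coprod_map_inr[OF A F A X lie_hom_id hom]
          copair_inl_apply[OF A X E s k] copair_inr_apply[OF A X E s k] closed xi)
    \<comment> \<open>The formula for \<xi> is available only on the kernel. The monad
      multiplication stays inside it, since it commutes with the projections to
      \<open>A\<close>.\<close>
    have in1: "flat_mult R A X w \<in> carrier (flat R A X)"
    proof -
      have p: "copair A id (zero_morphism A) \<in> lie_hom R (coproduct R A X) A"
        by (intro copair_hom A X lie_hom_id zero_morphism_hom)
      have p': "copair A id (zero_morphism A) \<in> lie_hom R (coproduct R A (flat R A X)) A"
        by (intro copair_hom A F lie_hom_id zero_morphism_hom)
      have "(copair A id (zero_morphism A) \<circ> copair (coproduct R A X) (coprod_inl R A X) (flat_incl R A X)) w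
          = copair A id (zero_morphism A) w"
        by (rule coproduct_hom_eqI[OF A F lie_hom_comp[OF mh p] p' _ _ w'])
          (simp_all add: copair_inl_apply[OF A F m] copair_inr_apply[OF A F m]
            copair_inl_apply[OF A X A lie_hom_id zero_morphism_hom[OF A]]
            copair_inl_apply[OF A F A lie_hom_id zero_morphism_hom[OF A]]
            copair_inr_apply[OF A F A lie_hom_id zero_morphism_hom[OF A]]
            flat_carrier)
      then show ?thesis
        using w by (simp add: flat_mult_def flat_carrier lie_hom_closed[OF mh])
    qed
    have in2: "flat_map R A (flat R A X) A X id \<xi> w \<in> carrier (flat R A X)"
      by (rule lie_hom_closed[OF flat_map_hom[OF A F A X lie_hom_id hom] w])
    show ?thesis
      using eq w in1 in2
      by (intro eqI) (simp_all add: closed xi flat_mult_def flat_map_apply)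
  qed
  show ?thesis
    by (simp add: internal_action_def same_morphism_def hom unit mult flat_unit_def)
qed

end

section \<open>Semi-direct products\<close>

lemma semidirect_simps [simp]:
  "carrier (semidirect A X act) = carrier X \<times> carrier A"
  "(x, a) \<oplus>\<^bsub>semidirect A X act\<^esub> (x', a') = (x \<oplus>\<^bsub>X\<^esub> x', a \<oplus>\<^bsub>A\<^esub> a')"
  "r \<odot>\<^bsub>semidirect A X act\<^esub> (x, a) = (r \<odot>\<^bsub>X\<^esub> x, r \<odot>\<^bsub>A\<^esub> a)"
  "\<zero>\<^bsub>semidirect A X act\<^esub> = (\<zero>\<^bsub>X\<^esub>, \<zero>\<^bsub>A\<^esub>)"
  "(x, a) \<otimes>\<^bsub>semidirect A X act\<^esub> (x', a') =
    (x \<otimes>\<^bsub>X\<^esub> x' \<oplus>\<^bsub>X\<^esub> (act a x' \<ominus>\<^bsub>X\<^esub> act a' x), a \<otimes>\<^bsub>A\<^esub> a')"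
  by (simp_all add: semidirect_def lie_product_def)

context
  fixes R :: "('r, 'k) ring_scheme"
    and A :: "('r, 'a, 'x) module_scheme" and X :: "('r, 'b, 'y) module_scheme"
    and act :: "'a \<Rightarrow> 'b \<Rightarrow> 'b"
  assumes A: "lie_algebra R A" and X: "lie_algebra R X" and act: "lie_action R A X act"
begin

interpretation A: lie_algebra R A by (rule A)
interpretation X: lie_algebra R X by (rule X)

lemma lie_action_closed [simp]: "\<lbrakk>a \<in> carrier A; x \<in> carrier X\<rbrakk> \<Longrightarrow> act a x \<in> carrier X"
  and lie_action_add_left: "\<lbrakk>a \<in> carrier A; a' \<in> carrier A; x \<in> carrier X\<rbrakk> \<Longrightarrow>
      act (a \<oplus>\<^bsub>A\<^esub> a') x = act a x \<oplus>\<^bsub>X\<^esub> act a' x"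
  and lie_action_add_right: "\<lbrakk>a \<in> carrier A; x \<in> carrier X; x' \<in> carrier X\<rbrakk> \<Longrightarrow>
      act a (x \<oplus>\<^bsub>X\<^esub> x') = act a x \<oplus>\<^bsub>X\<^esub> act a x'"
  and lie_action_smult_left: "\<lbrakk>r \<in> carrier R; a \<in> carrier A; x \<in> carrier X\<rbrakk> \<Longrightarrow>
      act (r \<odot>\<^bsub>A\<^esub> a) x = r \<odot>\<^bsub>X\<^esub> act a x"
  and lie_action_smult_right: "\<lbrakk>r \<in> carrier R; a \<in> carrier A; x \<in> carrier X\<rbrakk> \<Longrightarrow>
      act a (r \<odot>\<^bsub>X\<^esub> x) = r \<odot>\<^bsub>X\<^esub> act a x"
  and lie_action_bracket_left: "\<lbrakk>a \<in> carrier A; a' \<in> carrier A; x \<in> carrier X\<rbrakk> \<Longrightarrow>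
      act (a \<otimes>\<^bsub>A\<^esub> a') x = act a (act a' x) \<ominus>\<^bsub>X\<^esub> act a' (act a x)"
  and lie_action_bracket_right: "\<lbrakk>a \<in> carrier A; x \<in> carrier X; x' \<in> carrier X\<rbrakk> \<Longrightarrow>
      act a (x \<otimes>\<^bsub>X\<^esub> x') = act a x \<otimes>\<^bsub>X\<^esub> x' \<oplus>\<^bsub>X\<^esub> x \<otimes>\<^bsub>X\<^esub> act a x'"
  using act by (auto simp: lie_action_def)

lemma lie_action_zero_left: "x \<in> carrier X \<Longrightarrow> act \<zero>\<^bsub>A\<^esub> x = \<zero>\<^bsub>X\<^esub>"
  using lie_action_smult_left[OF A.R.zero_closed A.M.zero_closed] by simp

lemma lie_action_zero_right: "a \<in> carrier A \<Longrightarrow> act a \<zero>\<^bsub>X\<^esub> = \<zero>\<^bsub>X\<^esub>"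
  using lie_action_smult_right[OF A.R.zero_closed _ X.M.zero_closed] by simp

lemma lie_action_minus_right: "\<lbrakk>a \<in> carrier A; x \<in> carrier X\<rbrakk> \<Longrightarrow> act a (\<ominus>\<^bsub>X\<^esub> x) = \<ominus>\<^bsub>X\<^esub> act a x"
  using lie_action_add_right[of a "\<ominus>\<^bsub>X\<^esub> x" x]
  by (metis X.M.a_inv_closed X.M.l_neg X.M.minus_equality lie_action_closed lie_action_zero_right)

lemma lie_algebra_semidirect: "lie_algebra R (semidirect A X act)"
proof -
  let ?E = "semidirect A X act"
  have ag: "abelian_group ?E"
  proof (rule abelian_groupI)
    fix u assume "u \<in> carrier ?E"
    then obtain x a where "u = (x, a)" "x \<in> carrier X" "a \<in> carrier A" by auto
    then show "\<exists>v\<in>carrier ?E. v \<oplus>\<^bsub>?E\<^esub> u = \<zero>\<^bsub>?E\<^esub>"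
      by (intro bexI[of _ "(\<ominus>\<^bsub>X\<^esub> x, \<ominus>\<^bsub>A\<^esub> a)"]) (auto simp: X.M.l_neg A.M.l_neg)
  qed (auto simp: X.M.a_ac A.M.a_ac)
  have mod: "module R ?E"
    by (rule moduleI[OF A.R.cring_axioms ag])
      (auto simp: A.smult_l_distr A.smult_r_distr A.smult_assoc1
        X.smult_l_distr X.smult_r_distr X.smult_assoc1)
  have jac: "u \<otimes>\<^bsub>?E\<^esub> (v \<otimes>\<^bsub>?E\<^esub> w) \<oplus>\<^bsub>?E\<^esub> (v \<otimes>\<^bsub>?E\<^esub> (w \<otimes>\<^bsub>?E\<^esub> u) \<oplus>\<^bsub>?E\<^esub> w \<otimes>\<^bsub>?E\<^esub> (u \<otimes>\<^bsub>?E\<^esub> v)) = \<zero>\<^bsub>?E\<^esub>"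
    if u: "u \<in> carrier ?E" "v \<in> carrier ?E" "w \<in> carrier ?E" for u v w
  proof -
    obtain x a y b z c where uvw: "u = (x, a)" "v = (y, b)" "w = (z, c)"
      and [simp]: "x \<in> carrier X" "y \<in> carrier X" "z \<in> carrier X"
        "a \<in> carrier A" "b \<in> carrier A" "c \<in> carrier A"
      using u by auto
    \<comment> \<open>Moves the factor with the action to the left, so that equal terms become
      syntactically equal and can cancel.\<close>
    have *: "s \<otimes>\<^bsub>X\<^esub> act d t = \<ominus>\<^bsub>X\<^esub> (act d t \<otimes>\<^bsub>X\<^esub> s)"
      if "s \<in> carrier X" "t \<in> carrier X" "d \<in> carrier A" for s t d
      using that by (intro X.bracket_swap) auto
    \<comment> \<open>The Jacobi identity of \<open>X\<close>, solved for one cyclic term so that it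
      can be used as a rewrite rule.\<close>
    have j: "z \<otimes>\<^bsub>X\<^esub> (x \<otimes>\<^bsub>X\<^esub> y) = \<ominus>\<^bsub>X\<^esub> (x \<otimes>\<^bsub>X\<^esub> (y \<otimes>\<^bsub>X\<^esub> z)) \<ominus>\<^bsub>X\<^esub> y \<otimes>\<^bsub>X\<^esub> (z \<otimes>\<^bsub>X\<^esub> x)"
      using X.jacobi[of z x y] X.M.minus_equality[of "z \<otimes>\<^bsub>X\<^esub> (x \<otimes>\<^bsub>X\<^esub> y)"
        "x \<otimes>\<^bsub>X\<^esub> (y \<otimes>\<^bsub>X\<^esub> z) \<oplus>\<^bsub>X\<^esub> y \<otimes>\<^bsub>X\<^esub> (z \<otimes>\<^bsub>X\<^esub> x)"]
      by (simp add: X.M.minus_add X.M.minus_eq)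
    \<comment> \<open>In the first component, every term other than the Jacobi sum of \<open>X\<close> occurs once with each sign.\<close>
    let ?s = "x \<otimes>\<^bsub>X\<^esub> (y \<otimes>\<^bsub>X\<^esub> z) \<oplus>\<^bsub>X\<^esub> (y \<otimes>\<^bsub>X\<^esub> (z \<otimes>\<^bsub>X\<^esub> x) \<oplus>\<^bsub>X\<^esub> (act c y \<otimes>\<^bsub>X\<^esub> x \<oplus>\<^bsub>X\<^esub> (act a y \<otimes>\<^bsub>X\<^esub> z \<oplus>\<^bsub>X\<^esub> (
        act a (act b z) \<oplus>\<^bsub>X\<^esub> (act c (act b x) \<oplus>\<^bsub>X\<^esub> (act a z \<otimes>\<^bsub>X\<^esub> y \<oplus>\<^bsub>X\<^esub> (act b z \<otimes>\<^bsub>X\<^esub> x \<oplus>\<^bsub>X\<^esub> (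
        act b x \<otimes>\<^bsub>X\<^esub> z \<oplus>\<^bsub>X\<^esub> (act b (act c x) \<oplus>\<^bsub>X\<^esub> (act a (act c y) \<oplus>\<^bsub>X\<^esub> (act c x \<otimes>\<^bsub>X\<^esub> y \<oplus>\<^bsub>X\<^esub> (
        act c (act a y) \<oplus>\<^bsub>X\<^esub> (act b (act a z))))))))))))))"
    have "fst (u \<otimes>\<^bsub>?E\<^esub> (v \<otimes>\<^bsub>?E\<^esub> w) \<oplus>\<^bsub>?E\<^esub> (v \<otimes>\<^bsub>?E\<^esub> (w \<otimes>\<^bsub>?E\<^esub> u) \<oplus>\<^bsub>?E\<^esub> w \<otimes>\<^bsub>?E\<^esub> (u \<otimes>\<^bsub>?E\<^esub> v))) = ?s \<oplus>\<^bsub>X\<^esub> \<ominus>\<^bsub>X\<^esub> ?s"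
      by (simp add: uvw X.bracket_add_left X.bracket_add_right X.M.minus_eq
          X.bracket_minus_left X.bracket_minus_right lie_action_add_left lie_action_add_right
          lie_action_bracket_left lie_action_bracket_right lie_action_minus_right * X.M.minus_add j X.M.a_ac)
    also have "\<dots> = \<zero>\<^bsub>X\<^esub>"
      by (rule X.M.r_neg) simp
    \<comment> \<open>The second component is the Jacobi sum of \<open>A\<close>.\<close>
    finally show ?thesis
      using A.jacobi[of a b c] by (simp add: uvw)
  qed
  show ?thesis
    by (rule lie_algebra.intro[OF mod], unfold_locales)
     (use jac in \<open>auto simp: A.bracket_add_left A.bracket_add_right A.bracket_smult_left A.bracket_smult_right
       A.bracket_self X.bracket_add_left X.bracket_add_right X.bracket_smult_left X.bracket_smult_right
       X.bracket_self lie_action_add_left lie_action_add_right lie_action_smult_left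
       lie_action_smult_right X.M.minus_eq X.M.minus_add X.M.r_neg X.smult_r_distr X.smult_r_minus X.M.a_ac\<close>)
qed

private abbreviation (input) "E \<equiv> semidirect A X act"

interpretation E: lie_algebra R E by (rule lie_algebra_semidirect)

lemma semidirect_inl_hom: "(\<lambda>a. (\<zero>\<^bsub>X\<^esub>, a)) \<in> lie_hom R A E"
  by (rule lie_homI) (auto simp: lie_action_zero_right X.M.minus_eq)

lemma semidirect_inr_hom: "(\<lambda>x. (x, \<zero>\<^bsub>A\<^esub>)) \<in> lie_hom R X E"
  by (rule lie_homI) (auto simp: lie_action_zero_left X.M.minus_eq)

lemma semidirect_snd_hom: "snd \<in> lie_hom R E A"
  by (rule lie_homI) auto

text \<open>\<open>X\<close> is an ideal of the semi-direct product, on which (x', a) acts as the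
  bracket with x' plus the given action of a.\<close>

lemma semidirect_bracket_inr:
  assumes "e \<in> carrier E" "x \<in> carrier X"
  shows "e \<otimes>\<^bsub>E\<^esub> (x, \<zero>\<^bsub>A\<^esub>) = (fst e \<otimes>\<^bsub>X\<^esub> x \<oplus>\<^bsub>X\<^esub> act (snd e) x, \<zero>\<^bsub>A\<^esub>)"
  using assms by (cases e) (simp add: lie_action_zero_left X.M.minus_eq)

text \<open>A Lie algebra acts on \<open>X\<close> through any morphism to \<open>X \<rtimes> A\<close>, by the bracket of \<open>X \<rtimes> A\<close>.\<close>

context
  fixes B :: "('r, 'c, 'z) module_scheme" and \<phi>
  assumes B: "lie_algebra R B" and \<phi>: "\<phi> \<in> lie_hom R B E"
begin

text \<open>The second component of the induced morphism factors through the projection to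
  \<open>B\<close>, which vanishes on \<open>flat R B X\<close>.\<close>

lemma copair_semidirect_flat:
  assumes y: "y \<in> carrier (flat R B X)"
  shows "\<exists>x\<in>carrier X. copair E \<phi> (\<lambda>x. (x, \<zero>\<^bsub>A\<^esub>)) y = (x, \<zero>\<^bsub>A\<^esub>)"
proof -
  note h = copair_hom[OF B X E.lie_algebra_axioms \<phi> semidirect_inr_hom]
  have p: "copair B id (zero_morphism B) \<in> lie_hom R (coproduct R B X) B"
    by (intro copair_hom B X lie_hom_id zero_morphism_hom)
  note q = lie_hom_comp[OF \<phi> semidirect_snd_hom]
  have "(snd \<circ> copair E \<phi> (\<lambda>x. (x, \<zero>\<^bsub>A\<^esub>))) y = ((snd \<circ> \<phi>) \<circ> copair B id (zero_morphism B)) y"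
    using coproduct_hom_eqI[OF B X lie_hom_comp[OF h semidirect_snd_hom] lie_hom_comp[OF p q] _ _
        flat_subset[OF B X y]] lie_hom_zero[OF B A q]
    by (simp add: copair_inl_apply[OF B X E.lie_algebra_axioms \<phi> semidirect_inr_hom]
        copair_inr_apply[OF B X E.lie_algebra_axioms \<phi> semidirect_inr_hom]
        copair_inl_apply[OF B X B lie_hom_id zero_morphism_hom[OF B]]
        copair_inr_apply[OF B X B lie_hom_id zero_morphism_hom[OF B]])
  then have "snd (copair E \<phi> (\<lambda>x. (x, \<zero>\<^bsub>A\<^esub>)) y) = \<zero>\<^bsub>A\<^esub>"
    using y lie_hom_zero[OF B A q] by (simp add: flat_carrier)
  moreover have "copair E \<phi> (\<lambda>x. (x, \<zero>\<^bsub>A\<^esub>)) y \<in> carrier E"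
    using lie_hom_closed[OF h] y by (simp add: flat_carrier)
  ultimately show ?thesis
    by (cases "copair E \<phi> (\<lambda>x. (x, \<zero>\<^bsub>A\<^esub>)) y") simp
qed

lemma semidirect_internal_action:
  "internal_action R B X (\<lambda>y. fst (copair E \<phi> (\<lambda>x. (x, \<zero>\<^bsub>A\<^esub>)) y))"
  by (rule internal_actionI_embedding[OF B X E.lie_algebra_axioms \<phi> semidirect_inr_hom])
    (use copair_semidirect_flat in \<open>force simp: inj_on_def\<close>)+

end

text \<open>Discharges the description operator in the definition: existence is the previous
  factorisation for the structure map from \<open>A\<close>, and uniqueness is the injectivity of
  the structure map from \<open>X\<close>.\<close>

lemma corresponding_internal_action_apply:
  assumes y: "y \<in> carrier (flat R A X)"
  shows "corresponding_internal_action R A X act y \<in> carrier X"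
    and "copair E (\<lambda>a. (\<zero>\<^bsub>X\<^esub>, a)) (\<lambda>x. (x, \<zero>\<^bsub>A\<^esub>)) y =
      (corresponding_internal_action R A X act y, \<zero>\<^bsub>A\<^esub>)"
proof -
  obtain x where x: "x \<in> carrier X" "copair E (\<lambda>a. (\<zero>\<^bsub>X\<^esub>, a)) (\<lambda>x. (x, \<zero>\<^bsub>A\<^esub>)) y = (x, \<zero>\<^bsub>A\<^esub>)"
    using copair_semidirect_flat[OF A semidirect_inl_hom y] by blast
  then have "corresponding_internal_action R A X act y = x"
    using y unfolding corresponding_internal_action_def Let_def by (intro the_equality) auto
  with x show "corresponding_internal_action R A X act y \<in> carrier X"
    "copair E (\<lambda>a. (\<zero>\<^bsub>X\<^esub>, a)) (\<lambda>x. (x, \<zero>\<^bsub>A\<^esub>)) y =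
      (corresponding_internal_action R A X act y, \<zero>\<^bsub>A\<^esub>)" by simp_all
qed

lemma corresponding_internal_action:
  "internal_action R A X (corresponding_internal_action R A X act)"
  by (rule internal_actionI_embedding[OF A X E.lie_algebra_axioms semidirect_inl_hom semidirect_inr_hom])
    (simp_all add: corresponding_internal_action_apply inj_on_def)

text \<open>In the semi-direct product, [(0, a), (x, 0)] = (\<open>act a x\<close>, 0). Thus the
  values at the elements [a, x] recover the Lie algebra action.\<close>

lemma corresponding_internal_action_bracket:
  assumes "a \<in> carrier A" "x \<in> carrier X"
  shows "corresponding_internal_action R A X act
    (coprod_inl R A X a \<otimes>\<^bsub>coproduct R A X\<^esub> coprod_inr R A X x) = act a x"
proof -
  note h = A X E.lie_algebra_axioms semidirect_inl_hom semidirect_inr_hom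
  show ?thesis
    using corresponding_internal_action_apply(2)[OF flat_bracket_inr[OF A X assms]] assms
    by (simp add: lie_hom_bracket[OF copair_hom[OF h]] coprod_inl_closed[OF A X] coprod_inr_closed[OF A X]
        copair_inl_apply[OF h] copair_inr_apply[OF h] lie_action_zero_right lie_action_zero_left
        X.M.minus_eq)
qed

end

text \<open>
  With \<open>X = M\<close> and \<open>A = N\<close>, the Ellis condition says that \<open>[m, n]\<close> and \<open>\<^sup>mn\<close> have the same bracket with
  the elements of \<open>M\<close> in \<open>M \<rtimes> N\<close>; by induction, so do every \<open>z \<in> M \<flat> N\<close> and its image under the
  action of \<open>M\<close> on \<open>N\<close>.
\<close>

lemma ellis_flat_bracket:
  fixes act :: "'a \<Rightarrow> 'b \<Rightarrow> 'b"
  assumes X: "lie_algebra R X" and A: "lie_algebra R A"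
    and act: "lie_action R A X act" and act': "lie_action R X A act'"
    and ellis: "\<And>x x' a. \<lbrakk>x \<in> carrier X; x' \<in> carrier X; a \<in> carrier A\<rbrakk> \<Longrightarrow>
      act (act' x a) x' = x' \<otimes>\<^bsub>X\<^esub> act a x"
    and z: "z \<in> carrier (flat R X A)" and x': "x' \<in> carrier X"
  shows "copair (semidirect A X act) (\<lambda>x. (x, \<zero>\<^bsub>A\<^esub>)) (\<lambda>a. (\<zero>\<^bsub>X\<^esub>, a)) z
      \<otimes>\<^bsub>semidirect A X act\<^esub> (x', \<zero>\<^bsub>A\<^esub>) =
    (act (corresponding_internal_action R X A act' z) x', \<zero>\<^bsub>A\<^esub>)"
proof -
  define E where "E = semidirect A X act"
  define k :: "'b \<Rightarrow> 'b \<times> 'a" where "k = (\<lambda>x. (x, \<zero>\<^bsub>A\<^esub>))"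
  define \<theta> where "\<theta> = copair E k (\<lambda>a. (\<zero>\<^bsub>X\<^esub>, a))"
  define \<xi> where "\<xi> = corresponding_internal_action R X A act'"
  interpret A: lie_algebra R A by (rule A)
  interpret X: lie_algebra R X by (rule X)
  interpret E: lie_algebra R E unfolding E_def by (rule lie_algebra_semidirect[OF A X act])
  have k: "k \<in> lie_hom R X E"
    unfolding E_def k_def by (rule semidirect_inr_hom[OF A X act])
  have c: "lie_algebra R X" "lie_algebra R A" "lie_algebra R E" "k \<in> lie_hom R X E"
    "(\<lambda>a. (\<zero>\<^bsub>X\<^esub>, a)) \<in> lie_hom R A E"
    using X A E.lie_algebra_axioms k semidirect_inl_hom[OF A X act] by (simp_all add: E_def)
  note \<theta> = lie_hom_simps[OF copair_hom[OF c], folded \<theta>_def]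
  note k_simps = lie_hom_simps[OF k]
  note act_simps = lie_action_closed[OF A X act]
  have \<xi>: "internal_action R X A \<xi>"
    unfolding \<xi>_def by (rule corresponding_internal_action[OF X A act'])
  then have \<xi>_hom: "\<xi> \<in> lie_hom R (flat R X A) A" by (simp add: internal_action_def)
  note \<xi>_simps = lie_hom_simps[OF \<xi>_hom, unfolded flat_ops]
  \<comment> \<open>The quantifier over x' is kept in the induction: the hypothesis is used at x
    when z is bracketed with x, and at values of the action when two elements are bracketed.\<close>
  have "\<forall>x'\<in>carrier X. \<theta> z \<otimes>\<^bsub>E\<^esub> k x' = k (act (\<xi> z) x')"
    using X A z
  proof (induction rule: flat_induct)
    case (inr a)
    then show ?case
      using semidirect_bracket_inr[OF A X act, of "(\<zero>\<^bsub>X\<^esub>, a)"]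
      by (simp add: \<theta>_def copair_inr_apply[OF c] internal_action_inr[OF X A \<xi>])
        (simp add: E_def k_def act_simps)
  next
    case (inl_bracket x z)
    have zc: "\<theta> z \<in> carrier E" "k x \<in> carrier E" "\<xi> z \<in> carrier A" "z \<in> carrier (coproduct R X A)"
      using inl_bracket \<theta>(1) k_simps(1) \<xi>_simps(1) flat_subset[OF X A] by auto
    have \<xi>_eq: "\<xi> (coprod_inl R X A x \<otimes>\<^bsub>coproduct R X A\<^esub> z) = act' x (\<xi> z)"
      using internal_action_inl_bracket[OF X A \<xi> inl_bracket(1,2)]
        corresponding_internal_action_bracket[OF X A act' inl_bracket(1) zc(3)] by (simp add: \<xi>_def)
    have "\<theta> (coprod_inl R X A x \<otimes>\<^bsub>coproduct R X A\<^esub> z) = k x \<otimes>\<^bsub>E\<^esub> \<theta> z"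
      using inl_bracket zc by (simp add: \<theta> coprod_inl_closed[OF X A]) (simp add: \<theta>_def copair_inl_apply[OF c])
    also have "\<dots> = \<ominus>\<^bsub>E\<^esub> k (act (\<xi> z) x)"
      using inl_bracket zc E.bracket_swap[of "k x" "\<theta> z"] by simp
    finally have \<theta>_eq: "\<theta> (coprod_inl R X A x \<otimes>\<^bsub>coproduct R X A\<^esub> z) = \<ominus>\<^bsub>E\<^esub> k (act (\<xi> z) x)" .
    \<comment> \<open>The only use of the Ellis condition, with a = \<open>\<xi> z\<close>: it
      rewrites the right-hand side as the image of [x', \<open>act (\<xi> z) x\<close>], which is
      the left-hand side by antisymmetry.\<close>
    have "(\<ominus>\<^bsub>E\<^esub> k (act (\<xi> z) x)) \<otimes>\<^bsub>E\<^esub> k x' = k (act (act' x (\<xi> z)) x')"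
      if "x' \<in> carrier X" for x'
      using that inl_bracket(1) zc X.bracket_swap[of x' "act (\<xi> z) x"]
      by (simp add: act_simps ellis E.bracket_minus_left k_simps lie_hom_a_inv[OF X c(3) k])
    then show ?case by (simp add: \<theta>_eq \<xi>_eq)
  next
    case (add u v)
    then show ?case
      by (simp add: \<theta> \<xi>_simps E.bracket_add_left flat_subset[OF X A] k_simps act_simps
          lie_action_add_left[OF A X act])
  next
    case (smult r u)
    then show ?case
      by (simp add: \<theta> \<xi>_simps E.bracket_smult_left flat_subset[OF X A] k_simps act_simps
          lie_action_smult_left[OF A X act])
  next
    \<comment> \<open>Both sides become commutators, on the left by the Jacobi identity and on the
      right by the action axiom for brackets.\<close>
    case (bracket u v)
    then show ?case
      by (simp add: \<theta> \<xi>_simps E.bracket_bracket_left flat_subset[OF X A] k_simps act_simps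
          lie_action_bracket_left[OF A X act] lie_hom_minus[OF X c(3) k])
  qed
  then show ?thesis using x' by (simp add: \<theta>_def E_def k_def \<xi>_def)
qed

section \<open>Cosmash products\<close>

lemma cosmash_carrier:
  "x \<in> carrier (cosmash R A B) \<longleftrightarrow> x \<in> carrier (coproduct R A B) \<and>
    copair A id (zero_morphism A) x = \<zero>\<^bsub>A\<^esub> \<and> copair B (zero_morphism B) id x = \<zero>\<^bsub>B\<^esub>"
  by (simp add: cosmash_def lie_kernel_def a_kernel_def' lie_product_def)

lemma cosmash3_carrier:
  "x \<in> carrier (cosmash3 R A B C) \<longleftrightarrow> x \<in> carrier (coproduct R (coproduct R A B) C) \<and>
    copair (coproduct R A B) (copair (coproduct R A B) (coprod_inl R A B) (coprod_inr R A B))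
      (zero_morphism (coproduct R A B)) x = \<zero>\<^bsub>coproduct R A B\<^esub> \<and>
    copair (coproduct R A C) (copair (coproduct R A C) (coprod_inl R A C) (zero_morphism (coproduct R A C)))
      (coprod_inr R A C) x = \<zero>\<^bsub>coproduct R A C\<^esub> \<and>
    copair (coproduct R B C) (copair (coproduct R B C) (zero_morphism (coproduct R B C)) (coprod_inl R B C))
      (coprod_inr R B C) x = \<zero>\<^bsub>coproduct R B C\<^esub>"
  by (simp add: cosmash3_def Let_def lie_kernel_def a_kernel_def' lie_product_def coproduct3_def copair3_def)

lemma coproduct3_hom_eqI:
  assumes A: "lie_algebra R A" and B: "lie_algebra R B" and C: "lie_algebra R C"
    and f: "f \<in> lie_hom R (coproduct R (coproduct R A B) C) D"
    and g: "g \<in> lie_hom R (coproduct R (coproduct R A B) C) D"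
    and eqA: "\<And>a. a \<in> carrier A \<Longrightarrow> f (coprod_inl R (coproduct R A B) C (coprod_inl R A B a)) =
      g (coprod_inl R (coproduct R A B) C (coprod_inl R A B a))"
    and eqB: "\<And>b. b \<in> carrier B \<Longrightarrow> f (coprod_inl R (coproduct R A B) C (coprod_inr R A B b)) =
      g (coprod_inl R (coproduct R A B) C (coprod_inr R A B b))"
    and eqC: "\<And>c. c \<in> carrier C \<Longrightarrow> f (coprod_inr R (coproduct R A B) C c) =
      g (coprod_inr R (coproduct R A B) C c)"
    and w: "w \<in> carrier (coproduct R (coproduct R A B) C)"
  shows "f w = g w"
proof (rule coproduct_hom_eqI[OF lie_algebra_coproduct[OF A B] C f g _ eqC w])
  note i = coprod_inl_hom[OF lie_algebra_coproduct[OF A B] C]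
  fix u assume u: "u \<in> carrier (coproduct R A B)"
  show "f (coprod_inl R (coproduct R A B) C u) = g (coprod_inl R (coproduct R A B) C u)"
    using coproduct_hom_eqI[OF A B lie_hom_comp[OF i f] lie_hom_comp[OF i g] _ _ u]
    by (simp add: eqA eqB)
qed

lemmas coproduct_hom_simps = lie_algebra_coproduct copair_hom coprod_inl_hom coprod_inr_hom
  lie_hom_id zero_morphism_hom copair_inl_apply copair_inr_apply coprod_inl_closed coprod_inr_closed

text \<open>Shows that \<open>cosmash3_incl_flat\<close> lands in its intended codomain. The first
  component of the morphism defining the ternary cosmash product is the projection of (A + B) + C to
  A + B, because the two inclusions induce the identity of A + B.\<close>

lemma cosmash3_flat:
  assumes AB: "lie_algebra R A" "lie_algebra R B" and C: "lie_algebra R C"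
    and x: "x \<in> carrier (cosmash3 R A B C)"
  shows "x \<in> carrier (flat R (coproduct R A B) C)"
proof -
  note h = AB C coproduct_hom_simps
  let ?P = "coproduct R A B"
  have x': "x \<in> carrier (coproduct R ?P C)" using x by (simp add: cosmash3_carrier)
  have "copair ?P id (zero_morphism ?P) x =
      copair ?P (copair ?P (coprod_inl R A B) (coprod_inr R A B)) (zero_morphism ?P) x"
    by (rule coproduct3_hom_eqI[OF AB C _ _ _ _ _ x',
        where D = ?P and f = "copair ?P id (zero_morphism ?P)"
          and g = "copair ?P (copair ?P (coprod_inl R A B) (coprod_inr R A B)) (zero_morphism ?P)"]) (simp_all add: h)
  then show ?thesis using x by (simp add: cosmash3_carrier flat_carrier)
qed

text \<open>After folding, the projection to \<open>N\<close> factors through the component in M +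
  N, and the projection to \<open>M\<close> factors through the component in M + M by the
  codiagonal. Both components vanish on the cosmash product.\<close>

lemma fold_MNM_cosmash:
  assumes MN: "lie_algebra R M" "lie_algebra R N" and x: "x \<in> carrier (cosmash3 R M N M)"
  shows "fold_MNM R M N x \<in> carrier (cosmash R N M)"
proof -
  note h = MN coproduct_hom_simps
  let ?f = "copair (coproduct R N M) (copair (coproduct R N M) (coprod_inr R N M) (coprod_inl R N M))
    (coprod_inr R N M)"
  let ?MN = "copair (coproduct R M N) (copair (coproduct R M N) (coprod_inl R M N) (coprod_inr R M N))
    (zero_morphism (coproduct R M N))"
  let ?MM = "copair (coproduct R M M) (copair (coproduct R M M) (coprod_inl R M M)
    (zero_morphism (coproduct R M M))) (coprod_inr R M M)"
  have x': "x \<in> carrier (coproduct R (coproduct R M N) M)" using x by (simp add: cosmash3_carrier)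
  have f: "?f \<in> lie_hom R (coproduct R (coproduct R M N) M) (coproduct R N M)" by (simp add: h)
  have qN: "copair N (zero_morphism N) id \<in> lie_hom R (coproduct R M N) N" by (simp add: h)
  have qM: "copair M id id \<in> lie_hom R (coproduct R M M) M" by (simp add: h)
  have pN: "copair N id (zero_morphism N) \<in> lie_hom R (coproduct R N M) N" by (simp add: h)
  have gN: "?MN \<in> lie_hom R (coproduct R (coproduct R M N) M) (coproduct R M N)" by (simp add: h)
  have "(copair N id (zero_morphism N) \<circ> ?f) x = (copair N (zero_morphism N) id \<circ> ?MN) x"
    by (rule coproduct3_hom_eqI[OF MN MN(1) lie_hom_comp[OF f pN] lie_hom_comp[OF gN qN] _ _ _ x'])
      (simp_all add: h lie_hom_zero[OF _ _ qN])
  then have 1: "copair N id (zero_morphism N) (?f x) = \<zero>\<^bsub>N\<^esub>"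
    using x lie_hom_zero[OF _ _ qN] by (simp add: cosmash3_carrier h)
  have pM: "copair M (zero_morphism M) id \<in> lie_hom R (coproduct R N M) M" by (simp add: h)
  have gM: "?MM \<in> lie_hom R (coproduct R (coproduct R M N) M) (coproduct R M M)" by (simp add: h)
  have "(copair M (zero_morphism M) id \<circ> ?f) x = (copair M id id \<circ> ?MM) x"
    by (rule coproduct3_hom_eqI[OF MN MN(1) lie_hom_comp[OF f pM] lie_hom_comp[OF gM qM] _ _ _ x'])
      (simp_all add: h lie_hom_zero[OF _ _ qM])
  then have 2: "copair M (zero_morphism M) id (?f x) = \<zero>\<^bsub>M\<^esub>"
    using x lie_hom_zero[OF _ _ qM] by (simp add: cosmash3_carrier h)
  show ?thesis
    using 1 2 x lie_hom_closed[OF f x']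
    by (simp add: fold_MNM_def cosmash3_incl_def copair3_def cosmash_carrier)
qed

text \<open>As before, with the projection to \<open>M\<close> factoring through M + N and the
  projection to \<open>N\<close> through N + N and its codiagonal.\<close>

lemma fold_MNN_cosmash:
  assumes MN: "lie_algebra R M" "lie_algebra R N" and x: "x \<in> carrier (cosmash3 R M N N)"
  shows "fold_MNN R M N x \<in> carrier (cosmash R M N)"
proof -
  note h = MN coproduct_hom_simps
  let ?f = "copair (coproduct R M N) (copair (coproduct R M N) (coprod_inl R M N) (coprod_inr R M N))
    (coprod_inr R M N)"
  let ?MN = "copair (coproduct R M N) (copair (coproduct R M N) (coprod_inl R M N) (coprod_inr R M N))
    (zero_morphism (coproduct R M N))"
  let ?NN = "copair (coproduct R N N) (copair (coproduct R N N) (zero_morphism (coproduct R N N))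
    (coprod_inl R N N)) (coprod_inr R N N)"
  have x': "x \<in> carrier (coproduct R (coproduct R M N) N)" using x by (simp add: cosmash3_carrier)
  have f: "?f \<in> lie_hom R (coproduct R (coproduct R M N) N) (coproduct R M N)" by (simp add: h)
  have qM: "copair M id (zero_morphism M) \<in> lie_hom R (coproduct R M N) M" by (simp add: h)
  have qN: "copair N id id \<in> lie_hom R (coproduct R N N) N" by (simp add: h)
  have pM: "copair M id (zero_morphism M) \<in> lie_hom R (coproduct R M N) M" by (simp add: h)
  have gM: "?MN \<in> lie_hom R (coproduct R (coproduct R M N) N) (coproduct R M N)" by (simp add: h)
  have "(copair M id (zero_morphism M) \<circ> ?f) x = (copair M id (zero_morphism M) \<circ> ?MN) x"
    by (rule coproduct3_hom_eqI[OF MN MN(2) lie_hom_comp[OF f pM] lie_hom_comp[OF gM qM] _ _ _ x'])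
      (simp_all add: h lie_hom_zero[OF _ _ qM])
  then have 1: "copair M id (zero_morphism M) (?f x) = \<zero>\<^bsub>M\<^esub>"
    using x lie_hom_zero[OF _ _ qM] by (simp add: cosmash3_carrier h)
  have pN: "copair N (zero_morphism N) id \<in> lie_hom R (coproduct R M N) N" by (simp add: h)
  have gN: "?NN \<in> lie_hom R (coproduct R (coproduct R M N) N) (coproduct R N N)" by (simp add: h)
  have "(copair N (zero_morphism N) id \<circ> ?f) x = (copair N id id \<circ> ?NN) x"
    by (rule coproduct3_hom_eqI[OF MN MN(2) lie_hom_comp[OF f pN] lie_hom_comp[OF gN qN] _ _ _ x'])
      (simp_all add: h lie_hom_zero[OF _ _ qN])
  then have 2: "copair N (zero_morphism N) id (?f x) = \<zero>\<^bsub>N\<^esub>"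
    using x lie_hom_zero[OF _ _ qN] by (simp add: cosmash3_carrier h)
  show ?thesis
    using 1 2 x lie_hom_closed[OF f x']
    by (simp add: fold_MNN_def cosmash3_incl_def copair3_def cosmash_carrier)
qed

section \<open>Compatibility\<close>

lemma same_morphismI: "(\<And>x. x \<in> carrier A \<Longrightarrow> f x = g x) \<Longrightarrow> same_morphism A f g"
  by (simp add: same_morphism_def)

lemma conjugation_action_apply: "x \<in> carrier (flat R A A) \<Longrightarrow> conjugation_action R A x = copair A id id x"
  by (simp add: conjugation_action_def)

text \<open>
  In the following context \<open>X\<close> and \<open>Y\<close> are \<open>M\<close> and \<open>N\<close> in either order, \<open>P\<close> is \<open>M + N\<close>, and \<open>\<phi>\<close>
  is the canonical morphism from \<open>M + N\<close> to \<open>X \<rtimes> Y\<close>.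
\<close>

context
  fixes R :: "('r, 'k) ring_scheme"
    and Y :: "('r, 'a, 'x) module_scheme" and X :: "('r, 'b, 'y) module_scheme"
    and act :: "'a \<Rightarrow> 'b \<Rightarrow> 'b"
    and P :: "('r, 'p, 'z) module_scheme" and iX iY \<phi>
  assumes Y: "lie_algebra R Y" and X: "lie_algebra R X" and act: "lie_action R Y X act"
    and P: "lie_algebra R P" and iX: "iX \<in> lie_hom R X P" and iY: "iY \<in> lie_hom R Y P"
    and \<phi>: "\<phi> \<in> lie_hom R P (semidirect Y X act)"
    and \<phi>_iX: "\<And>x. x \<in> carrier X \<Longrightarrow> \<phi> (iX x) = (x, \<zero>\<^bsub>Y\<^esub>)"
    and \<phi>_iY: "\<And>y. y \<in> carrier Y \<Longrightarrow> \<phi> (iY y) = (\<zero>\<^bsub>X\<^esub>, y)"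
begin

private abbreviation (input) "XY \<equiv> semidirect Y X act"
private abbreviation (input) "k \<equiv> \<lambda>x. (x, \<zero>\<^bsub>Y\<^esub>)"
private abbreviation (input) "s \<equiv> \<lambda>y. (\<zero>\<^bsub>X\<^esub>, y)"
private abbreviation (input) "\<xi> \<equiv> \<lambda>w. fst (copair XY \<phi> k w)"

interpretation E: lie_algebra R XY by (rule lie_algebra_semidirect[OF Y X act])

private lemmas k_hom = semidirect_inr_hom[OF Y X act]
private lemmas s_hom = semidirect_inl_hom[OF Y X act]
private lemmas Pk = P X E.lie_algebra_axioms \<phi> k_hom
private lemmas sk = Y X E.lie_algebra_axioms s_hom k_hom

lemma induced_action: "internal_action R P X \<xi>"
  by (rule semidirect_internal_action[OF Y X act P \<phi>])

text \<open>Composing \<phi> with \<open>iY\<close> gives the structure map s, so the restricted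
  action is computed by the same induced morphism as the corresponding internal action.\<close>

lemma induced_action_iY:
  "same_morphism (flat R Y X) (\<xi> \<circ> flat_map R Y X P X iY id) (corresponding_internal_action R Y X act)"
proof (rule same_morphismI)
  fix w assume w: "w \<in> carrier (flat R Y X)"
  note c = coprod_map_hom[OF Y X P X iY lie_hom_id]
  have "(copair XY \<phi> k \<circ> coprod_map R P X iY id) w = copair XY s k w"
    by (rule coproduct_hom_eqI[OF Y X lie_hom_comp[OF c copair_hom[OF Pk]] copair_hom[OF sk]
          _ _ flat_subset[OF Y X w]])
      (simp_all add: coprod_map_inl[OF Y X P X iY lie_hom_id] coprod_map_inr[OF Y X P X iY lie_hom_id]
        copair_inl_apply[OF Pk] copair_inr_apply[OF Pk] copair_inl_apply[OF sk] copair_inr_apply[OF sk]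
        lie_hom_closed[OF iY] \<phi>_iY)
  then show "(\<xi> \<circ> flat_map R Y X P X iY id) w = corresponding_internal_action R Y X act w"
    using w by (simp add: flat_map_apply corresponding_internal_action_apply[OF Y X act])
qed

text \<open>Composing \<phi> with \<open>iX\<close> gives k. Both copies of \<open>X\<close> are
  then sent to the semi-direct product by k, which is the codiagonal followed by k.\<close>

lemma induced_action_iX:
  "same_morphism (flat R X X) (\<xi> \<circ> flat_map R X X P X iX id) (conjugation_action R X)"
proof (rule same_morphismI)
  fix w assume w: "w \<in> carrier (flat R X X)"
  note c = coprod_map_hom[OF X X P X iX lie_hom_id]
  note ii = X X X lie_hom_id lie_hom_id
  have "(copair XY \<phi> k \<circ> coprod_map R P X iX id) w = (k \<circ> copair X id id) w"
    by (rule coproduct_hom_eqI[OF X X lie_hom_comp[OF c copair_hom[OF Pk]]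
          lie_hom_comp[OF copair_hom[OF ii] k_hom] _ _ flat_subset[OF X X w]])
      (simp_all add: coprod_map_inl[OF X X P X iX lie_hom_id] coprod_map_inr[OF X X P X iX lie_hom_id]
        copair_inl_apply[OF Pk] copair_inr_apply[OF Pk] copair_inl_apply[OF ii] copair_inr_apply[OF ii]
        lie_hom_closed[OF iX] \<phi>_iX)
  then show "(\<xi> \<circ> flat_map R X X P X iX id) w = conjugation_action R X w"
    using w by (simp add: flat_map_apply conjugation_action_apply)
qed

text \<open>The cosmash clause of (CA.0). By \<open>fac\<close>, \<phi> factors through Y + X as
  \<psi> followed by the morphism induced by s and k; hence so does the morphism defining \<xi>. For
  suitable \<psi>, the morphism induced by \<psi> and the inclusion of \<open>X\<close> is the
  folding.\<close>

lemma induced_action_fold: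
  assumes \<psi>: "\<psi> \<in> lie_hom R P (coproduct R Y X)"
    and fac: "\<And>u. u \<in> carrier P \<Longrightarrow> copair XY s k (\<psi> u) = \<phi> u"
    and w: "w \<in> carrier (flat R P X)"
    and w': "copair (coproduct R Y X) \<psi> (coprod_inr R Y X) w \<in> carrier (flat R Y X)"
  shows "\<xi> w = corresponding_internal_action R Y X act
    (copair (coproduct R Y X) \<psi> (coprod_inr R Y X) w)"
proof -
  note f = P X lie_algebra_coproduct[OF Y X] \<psi> coprod_inr_hom[OF Y X]
  have "(copair XY s k \<circ> copair (coproduct R Y X) \<psi> (coprod_inr R Y X)) w = copair XY \<phi> k w"
    by (rule coproduct_hom_eqI[OF P X lie_hom_comp[OF copair_hom[OF f] copair_hom[OF sk]] copair_hom[OF Pk]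
          _ _ flat_subset[OF P X w]])
      (simp_all add: copair_inl_apply[OF f] copair_inr_apply[OF f] copair_inl_apply[OF Pk]
        copair_inr_apply[OF Pk] copair_inr_apply[OF sk] fac)
  then have "copair XY \<phi> k w = k (corresponding_internal_action R Y X act
      (copair (coproduct R Y X) \<psi> (coprod_inr R Y X) w))"
    using corresponding_internal_action_apply(2)[OF Y X act w'] by simp
  then show ?thesis by simp
qed

text \<open>The elements u for which the images of f u and g u have the same brackets with
  \<open>X\<close> are closed under all operations, so (CA.M) and (CA.N) need checking only on the
  two summands.\<close>

lemma induced_action_agree:
  assumes F: "lie_algebra R F" and G: "lie_algebra R G"
    and f: "f \<in> lie_hom R (coproduct R F G) P" and g: "g \<in> lie_hom R (coproduct R F G) P"
    and inl: "\<And>u x. \<lbrakk>u \<in> carrier F; x \<in> carrier X\<rbrakk> \<Longrightarrow>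
      \<phi> (f (coprod_inl R F G u)) \<otimes>\<^bsub>XY\<^esub> k x = \<phi> (g (coprod_inl R F G u)) \<otimes>\<^bsub>XY\<^esub> k x"
    and inr: "\<And>u x. \<lbrakk>u \<in> carrier G; x \<in> carrier X\<rbrakk> \<Longrightarrow>
      \<phi> (f (coprod_inr R F G u)) \<otimes>\<^bsub>XY\<^esub> k x = \<phi> (g (coprod_inr R F G u)) \<otimes>\<^bsub>XY\<^esub> k x"
  shows "same_morphism (flat R (coproduct R F G) X)
    (\<xi> \<circ> flat_map R (coproduct R F G) X P X f id) (\<xi> \<circ> flat_map R (coproduct R F G) X P X g id)"
proof (rule internal_action_flat_map_agree[OF P X induced_action lie_algebra_coproduct[OF F G] f g])
  interpret Y: lie_algebra R Y by (rule Y)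
  interpret X: lie_algebra R X by (rule X)
  have kc: "k x \<in> carrier XY" if "x \<in> carrier X" for x using that by simp
  have ideal: "\<exists>x'\<in>carrier X. e \<otimes>\<^bsub>XY\<^esub> k x = k x'" if "e \<in> carrier XY" "x \<in> carrier X" for e x
    using that lie_action_closed[OF Y X act]
    by (intro bexI[of _ "fst e \<otimes>\<^bsub>X\<^esub> x \<oplus>\<^bsub>X\<^esub> act (snd e) x"]) (auto simp: semidirect_bracket_inr[OF Y X act])
  have agree: "\<forall>x\<in>carrier X. \<phi> (f u) \<otimes>\<^bsub>XY\<^esub> k x = \<phi> (g u) \<otimes>\<^bsub>XY\<^esub> k x"
    if u: "u \<in> carrier (coproduct R F G)" for u
    using F G u
  proof (induction rule: coproduct_induct)
    case (inl a) then show ?case using assms(5) by blast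
  next
    case (inr a) then show ?case using assms(6) by blast
  next
    case (add u v)
    then show ?case
      by (simp add: lie_hom_simps[OF f] lie_hom_simps[OF g] lie_hom_simps[OF \<phi>] E.bracket_add_left kc
          del: semidirect_simps)
  next
    case (smult r u)
    then show ?case
      by (simp add: lie_hom_simps[OF f] lie_hom_simps[OF g] lie_hom_simps[OF \<phi>] E.bracket_smult_left kc
          del: semidirect_simps)
  next
    case (bracket u v)
    \<comment> \<open>The inner bracket lies in \<open>X\<close> by \<open>ideal\<close>, so the
      hypothesis on u can be applied to it.\<close>
    have 1: "\<phi> (f u) \<otimes>\<^bsub>XY\<^esub> (\<phi> (f v) \<otimes>\<^bsub>XY\<^esub> k x) = \<phi> (g u) \<otimes>\<^bsub>XY\<^esub> (\<phi> (g v) \<otimes>\<^bsub>XY\<^esub> k x)"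
      if *: "x \<in> carrier X" "u \<in> carrier (coproduct R F G)" "v \<in> carrier (coproduct R F G)"
        "\<forall>x\<in>carrier X. \<phi> (f u) \<otimes>\<^bsub>XY\<^esub> k x = \<phi> (g u) \<otimes>\<^bsub>XY\<^esub> k x"
        "\<forall>x\<in>carrier X. \<phi> (f v) \<otimes>\<^bsub>XY\<^esub> k x = \<phi> (g v) \<otimes>\<^bsub>XY\<^esub> k x" for x u v
    proof -
      obtain x' where "x' \<in> carrier X" "\<phi> (g v) \<otimes>\<^bsub>XY\<^esub> k x = k x'"
        using ideal[OF lie_hom_closed[OF \<phi> lie_hom_closed[OF g *(3)]] *(1)] by blast
      then show ?thesis using * by (simp del: semidirect_simps)
    qed
    show ?case
      using bracket 1[of _ u v] 1[of _ v u]
      by (simp add: lie_hom_simps[OF f] lie_hom_simps[OF g] lie_hom_simps[OF \<phi>] E.bracket_bracket_left kc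
          del: semidirect_simps)
  qed
  have \<xi>_bracket: "\<xi> (coprod_inl R P X p \<otimes>\<^bsub>coproduct R P X\<^esub> coprod_inr R P X x) = fst (\<phi> p \<otimes>\<^bsub>XY\<^esub> k x)"
    if "p \<in> carrier P" "x \<in> carrier X" for p x
    using that by (simp add: lie_hom_bracket[OF copair_hom[OF Pk]] coprod_inl_closed[OF P X] coprod_inr_closed[OF P X]
        copair_inl_apply[OF Pk] copair_inr_apply[OF Pk] del: semidirect_simps)
  show "\<xi> (coprod_inl R P X (f u) \<otimes>\<^bsub>coproduct R P X\<^esub> coprod_inr R P X x) =
      \<xi> (coprod_inl R P X (g u) \<otimes>\<^bsub>coproduct R P X\<^esub> coprod_inr R P X x)"
    if "u \<in> carrier (coproduct R F G)" "x \<in> carrier X" for u x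
    using that agree by (simp add: \<xi>_bracket lie_hom_closed[OF f] lie_hom_closed[OF g] del: semidirect_simps)
qed

end

text \<open>Kept symmetric so that it serves both Ellis equations. In its uses y' is the result of x
  acting on y, and \<open>eq\<close> is the compatibility condition evaluated at [[x, y],
  x'].\<close>

lemma ellis_from_internal_action:
  assumes Y: "lie_algebra R Y" and X: "lie_algebra R X" and act: "lie_action R Y X act"
    and P: "lie_algebra R P" and iX: "iX \<in> lie_hom R X P" and iY: "iY \<in> lie_hom R Y P"
    and \<xi>: "internal_action R P X \<xi>"
    and \<xi>_iY: "same_morphism (flat R Y X) (\<xi> \<circ> flat_map R Y X P X iY id) (corresponding_internal_action R Y X act)"
    and \<xi>_iX: "same_morphism (flat R X X) (\<xi> \<circ> flat_map R X X P X iX id) (conjugation_action R X)"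
    and x: "x \<in> carrier X" "x' \<in> carrier X" and y: "y \<in> carrier Y" "y' \<in> carrier Y"
    and eq: "\<xi> (coprod_inl R P X (iY y') \<otimes>\<^bsub>coproduct R P X\<^esub> coprod_inr R P X x') =
      \<xi> (coprod_inl R P X (iX x \<otimes>\<^bsub>P\<^esub> iY y) \<otimes>\<^bsub>coproduct R P X\<^esub> coprod_inr R P X x')"
  shows "act y' x' = x' \<otimes>\<^bsub>X\<^esub> act y x"
proof -
  interpret X: lie_algebra R X by (rule X)
  interpret PX: lie_algebra R "coproduct R P X" by (rule lie_algebra_coproduct[OF P X])
  have \<xi>_hom: "\<xi> \<in> lie_hom R (flat R P X) X" using \<xi> by (simp add: internal_action_def)
  have iYc [simp]: "v \<in> carrier Y \<Longrightarrow> iY v \<in> carrier P" for v by (rule lie_hom_closed[OF iY])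
  have iXc [simp]: "v \<in> carrier X \<Longrightarrow> iX v \<in> carrier P" for v by (rule lie_hom_closed[OF iX])
  note inl = lie_hom_bracket[OF coprod_inl_hom[OF P X]]
  let ?b = "\<lambda>u v. coprod_inl R P X u \<otimes>\<^bsub>coproduct R P X\<^esub> coprod_inr R P X v"
  have bY: "\<xi> (?b (iY v) u) = act v u" if "v \<in> carrier Y" "u \<in> carrier X" for u v
    using bspec[OF \<xi>_iY[unfolded same_morphism_def] flat_bracket_inr[OF Y X that]] that
    by (simp add: flat_map_apply flat_bracket_inr[OF Y X] corresponding_internal_action_bracket[OF Y X act]
        lie_hom_bracket[OF coprod_map_hom[OF Y X P X iY lie_hom_id]] coprod_inl_closed[OF Y X] coprod_inr_closed[OF Y X]
        coprod_map_inl[OF Y X P X iY lie_hom_id] coprod_map_inr[OF Y X P X iY lie_hom_id])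
  have bX: "\<xi> (?b (iX v) u) = v \<otimes>\<^bsub>X\<^esub> u" if "v \<in> carrier X" "u \<in> carrier X" for u v
    using bspec[OF \<xi>_iX[unfolded same_morphism_def] flat_bracket_inr[OF X X that]] that
    by (simp add: flat_map_apply flat_bracket_inr[OF X X] conjugation_action_apply
        lie_hom_bracket[OF copair_hom[OF X X X lie_hom_id lie_hom_id]]
        copair_inl_apply[OF X X X lie_hom_id lie_hom_id] copair_inr_apply[OF X X X lie_hom_id lie_hom_id]
        lie_hom_bracket[OF coprod_map_hom[OF X X P X iX lie_hom_id]] coprod_inl_closed[OF X X] coprod_inr_closed[OF X X]
        coprod_map_inl[OF X X P X iX lie_hom_id] coprod_map_inr[OF X X P X iX lie_hom_id])
  note ac = lie_action_closed[OF Y X act]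
  \<comment> \<open>The inner bracket is not in \<open>X\<close> but in the kernel; the
    associativity axiom replaces it by its value under \<xi>.\<close>
  have bb: "\<xi> (coprod_inl R P X u \<otimes>\<^bsub>coproduct R P X\<^esub> ?b v z) = \<xi> (?b u (\<xi> (?b v z)))"
    if "u \<in> carrier P" "v \<in> carrier P" "z \<in> carrier X" for u v z
    using that by (intro internal_action_inl_bracket[OF P X \<xi>] flat_bracket_inr[OF P X])
  have "act y' x' = \<xi> (?b (iX x \<otimes>\<^bsub>P\<^esub> iY y) x')" using eq x y by (simp add: bY)
  \<comment> \<open>The Jacobi identity, with the difference formed in \<open>flat R P X\<close>
    because that is the domain on which \<xi> is a morphism.\<close>
  also have "\<dots> = \<xi> (coprod_inl R P X (iX x) \<otimes>\<^bsub>coproduct R P X\<^esub> ?b (iY y) x'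
      \<ominus>\<^bsub>flat R P X\<^esub> coprod_inl R P X (iY y) \<otimes>\<^bsub>coproduct R P X\<^esub> ?b (iX x) x')"
    using x y by (simp add: inl PX.bracket_bracket_left flat_minus[OF P X]
        flat_bracket_inl[OF P X] flat_bracket_inr[OF P X] coprod_inl_closed[OF P X] coprod_inr_closed[OF P X])
  also have "\<dots> = x \<otimes>\<^bsub>X\<^esub> act y x' \<ominus>\<^bsub>X\<^esub> act y (x \<otimes>\<^bsub>X\<^esub> x')"
    using x y by (subst lie_hom_minus[OF lie_algebra_flat[OF P X] X \<xi>_hom])
      (simp_all add: bb bX bY ac flat_bracket_inl[OF P X] flat_bracket_inr[OF P X])
  \<comment> \<open>Since \<open>act y\<close> is a derivation, [x, \<open>act y x'\<close>]
    cancels, and antisymmetry turns the remaining term around.\<close>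
  also have "\<dots> = x' \<otimes>\<^bsub>X\<^esub> act y x"
  proof -
    have "act y x \<otimes>\<^bsub>X\<^esub> x' = \<ominus>\<^bsub>X\<^esub> (x' \<otimes>\<^bsub>X\<^esub> act y x)"
      using x y by (intro X.bracket_swap) (auto simp: ac)
    then show ?thesis
      using x y X.M.a_lcomm[of "x \<otimes>\<^bsub>X\<^esub> act y x'" "x' \<otimes>\<^bsub>X\<^esub> act y x" "\<ominus>\<^bsub>X\<^esub> (x \<otimes>\<^bsub>X\<^esub> act y x')"]
      by (simp add: lie_action_bracket_right[OF Y X act] ac X.M.minus_eq X.M.minus_add X.M.r_neg)
  qed
  finally show ?thesis .
qed

theorem corollary3p13:
  fixes R :: "('r, 'k) ring_scheme"
    and M :: "('r, 'm, 'x) module_scheme"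
    and N :: "('r, 'n, 'y) module_scheme"
    and actMN :: "'m \<Rightarrow> 'n \<Rightarrow> 'n"
    and actNM :: "'n \<Rightarrow> 'm \<Rightarrow> 'm"
  assumes "cring R"
    and "lie_algebra R M"
    and "lie_algebra R N"
    and "lie_action R M N actMN"
    and "lie_action R N M actNM"
  shows "internally_compatible R M N
      (corresponding_internal_action R M N actMN) (corresponding_internal_action R N M actNM)
    \<longleftrightarrow> ellis_compatible M N actMN actNM"
proof -
  note M = assms(2) and N = assms(3) and a = assms(4) and b = assms(5)
  define \<xi>MN where "\<xi>MN = corresponding_internal_action R M N actMN"
  define \<xi>NM where "\<xi>NM = corresponding_internal_action R N M actNM"
  let ?P = "coproduct R M N" and ?iM = "coprod_inl R M N" and ?iN = "coprod_inr R M N"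
  let ?F = "flat R N M" and ?G = "flat R M N"
  let ?K = "coproduct R ?F ?G"
  let ?\<xi>\<xi> = "coprod_map R M N \<xi>NM \<xi>MN"
  let ?swap = "coprod_swap R M N"
  let ?kk = "copair ?P (?swap \<circ> flat_incl R N M) (flat_incl R M N)"
  interpret M: lie_algebra R M by (rule M)
  interpret N: lie_algebra R N by (rule N)
  note P = lie_algebra_coproduct[OF M N] and F = lie_algebra_flat[OF N M] and G = lie_algebra_flat[OF M N]
  note iM = coprod_inl_hom[OF M N] and iN = coprod_inr_hom[OF M N]
  have actMN: "internal_action R M N \<xi>MN" and actNM: "internal_action R N M \<xi>NM"
    unfolding \<xi>MN_def \<xi>NM_def by (rule corresponding_internal_action[OF M N a] corresponding_internal_action[OF N M b])+
  then have \<xi>MN: "\<xi>MN \<in> lie_hom R ?G N" and \<xi>NM: "\<xi>NM \<in> lie_hom R ?F M"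
    by (simp_all add: internal_action_def)
  note h\<xi>\<xi> = coprod_map_hom[OF F G M N \<xi>NM \<xi>MN]
  note sw = N M P iN iM
  have swap: "?swap \<in> lie_hom R (coproduct R N M) ?P"
    unfolding coprod_swap_def by (rule copair_hom[OF sw])
  note kc = F G P lie_hom_comp[OF flat_incl_hom[OF N M] swap] flat_incl_hom[OF M N]
  note hkk = copair_hom[OF kc]
  note K = lie_algebra_coproduct[OF F G]
  have \<xi>\<xi>_inl: "?\<xi>\<xi> (coprod_inl R ?F ?G u) = ?iM (\<xi>NM u)" if "u \<in> carrier ?F" for u
    by (rule coprod_map_inl[OF F G M N \<xi>NM \<xi>MN that])
  have \<xi>\<xi>_inr: "?\<xi>\<xi> (coprod_inr R ?F ?G u) = ?iN (\<xi>MN u)" if "u \<in> carrier ?G" for u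
    by (rule coprod_map_inr[OF F G M N \<xi>NM \<xi>MN that])
  have kk_inl: "?kk (coprod_inl R ?F ?G u) = ?swap u" if "u \<in> carrier ?F" for u
    using copair_inl_apply[OF kc that] that by simp
  have kk_inr: "?kk (coprod_inr R ?F ?G u) = u" if "u \<in> carrier ?G" for u
    using copair_inr_apply[OF kc that] that by simp
  note \<xi>_simps = lie_hom_closed[OF \<xi>MN] lie_hom_closed[OF \<xi>NM]
  show ?thesis
  proof
    assume "internally_compatible R M N (corresponding_internal_action R M N actMN)
      (corresponding_internal_action R N M actNM)"
    then obtain \<xi>M \<xi>N where \<xi>M: "internal_action R ?P M \<xi>M" and \<xi>N: "internal_action R ?P N \<xi>N"
      and M1: "same_morphism (flat R N M) (\<xi>M \<circ> flat_map R N M ?P M ?iN id) \<xi>NM"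
      and M2: "same_morphism (flat R M M) (\<xi>M \<circ> flat_map R M M ?P M ?iM id) (conjugation_action R M)"
      and N1: "same_morphism (flat R M N) (\<xi>N \<circ> flat_map R M N ?P N ?iM id) \<xi>MN"
      and N2: "same_morphism (flat R N N) (\<xi>N \<circ> flat_map R N N ?P N ?iN id) (conjugation_action R N)"
      and CM: "same_morphism (flat R ?K M) (\<xi>M \<circ> flat_map R ?K M ?P M ?\<xi>\<xi> id)
        (\<xi>M \<circ> flat_map R ?K M ?P M ?kk id)"
      and CN: "same_morphism (flat R ?K N) (\<xi>N \<circ> flat_map R ?K N ?P N ?\<xi>\<xi> id)
        (\<xi>N \<circ> flat_map R ?K N ?P N ?kk id)"
      unfolding internally_compatible_def Let_def \<xi>MN_def[symmetric] \<xi>NM_def[symmetric] by blast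
    \<comment> \<open>(CA.M) at the element [u, m] of \<open>flat R ?K M\<close>.\<close>
    have CM': "\<xi>M (coprod_inl R ?P M (?\<xi>\<xi> u) \<otimes>\<^bsub>coproduct R ?P M\<^esub> coprod_inr R ?P M m) =
        \<xi>M (coprod_inl R ?P M (?kk u) \<otimes>\<^bsub>coproduct R ?P M\<^esub> coprod_inr R ?P M m)"
      if "u \<in> carrier ?K" "m \<in> carrier M" for u m
      using bspec[OF CM[unfolded same_morphism_def] flat_bracket_inr[OF K M that]] that
      by (simp add: flat_map_apply flat_bracket_inr[OF K M] coprod_inl_closed[OF K M] coprod_inr_closed[OF K M]
          lie_hom_bracket[OF coprod_map_hom[OF K M P M h\<xi>\<xi> lie_hom_id]]
          lie_hom_bracket[OF coprod_map_hom[OF K M P M hkk lie_hom_id]]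
          coprod_map_inl[OF K M P M h\<xi>\<xi> lie_hom_id] coprod_map_inr[OF K M P M h\<xi>\<xi> lie_hom_id]
          coprod_map_inl[OF K M P M hkk lie_hom_id] coprod_map_inr[OF K M P M hkk lie_hom_id])
    have CN': "\<xi>N (coprod_inl R ?P N (?\<xi>\<xi> u) \<otimes>\<^bsub>coproduct R ?P N\<^esub> coprod_inr R ?P N n) =
        \<xi>N (coprod_inl R ?P N (?kk u) \<otimes>\<^bsub>coproduct R ?P N\<^esub> coprod_inr R ?P N n)"
      if "u \<in> carrier ?K" "n \<in> carrier N" for u n
      using bspec[OF CN[unfolded same_morphism_def] flat_bracket_inr[OF K N that]] that
      by (simp add: flat_map_apply flat_bracket_inr[OF K N] coprod_inl_closed[OF K N] coprod_inr_closed[OF K N]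
          lie_hom_bracket[OF coprod_map_hom[OF K N P N h\<xi>\<xi> lie_hom_id]]
          lie_hom_bracket[OF coprod_map_hom[OF K N P N hkk lie_hom_id]]
          coprod_map_inl[OF K N P N h\<xi>\<xi> lie_hom_id] coprod_map_inr[OF K N P N h\<xi>\<xi> lie_hom_id]
          coprod_map_inl[OF K N P N hkk lie_hom_id] coprod_map_inr[OF K N P N hkk lie_hom_id])
    have "actNM (actMN m n) m' = m' \<otimes>\<^bsub>M\<^esub> actNM n m"
      if m: "m \<in> carrier M" "m' \<in> carrier M" and n: "n \<in> carrier N" for m m' n
    proof -
      \<comment> \<open>Placed in the right summand of \<open>?K\<close>, [m, n] goes to the
        inclusion of \<open>actMN m n\<close> under \<open>?\<xi>\<xi>\<close> and to itself under
        \<open>?kk\<close>.\<close>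
      let ?u = "?iM m \<otimes>\<^bsub>?P\<^esub> ?iN n"
      have u: "?u \<in> carrier ?G" by (rule flat_bracket_inr[OF M N m(1) n])
      have "\<xi>MN ?u = actMN m n"
        unfolding \<xi>MN_def by (rule corresponding_internal_action_bracket[OF M N a m(1) n])
      then show ?thesis
        using ellis_from_internal_action[OF N M b P iM iN \<xi>M M1[unfolded \<xi>NM_def] M2 m n, of "actMN m n"]
          CM'[OF coprod_inr_closed[OF F G u] m(2)] lie_action_closed[OF M N a m(1) n]
        by (simp add: \<xi>\<xi>_inr[OF u] kk_inr[OF u])
    qed
    moreover have "actMN (actNM n m) n' = n' \<otimes>\<^bsub>N\<^esub> actMN m n"
      if m: "m \<in> carrier M" and n: "n \<in> carrier N" "n' \<in> carrier N" for m n n'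
    proof -
      \<comment> \<open>Now [n, m] lies in N + M and in the left summand of \<open>?K\<close>, so
        \<open>?kk\<close> moves it to M + N by \<open>?swap\<close>.\<close>
      let ?u = "coprod_inl R N M n \<otimes>\<^bsub>coproduct R N M\<^esub> coprod_inr R N M m"
      have u: "?u \<in> carrier ?F" by (rule flat_bracket_inr[OF N M n(1) m])
      have "\<xi>NM ?u = actNM n m"
        unfolding \<xi>NM_def by (rule corresponding_internal_action_bracket[OF N M b n(1) m])
      moreover have "?swap ?u = ?iN n \<otimes>\<^bsub>?P\<^esub> ?iM m"
        using m n by (simp add: lie_hom_bracket[OF swap] coprod_inl_closed[OF N M] coprod_inr_closed[OF N M])
          (simp add: coprod_swap_def copair_inl_apply[OF sw] copair_inr_apply[OF sw])
      ultimately show ?thesis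
        using ellis_from_internal_action[OF M N a P iN iM \<xi>N N1[unfolded \<xi>MN_def] N2 n m, of "actNM n m"]
          CN'[OF coprod_inl_closed[OF F G u] n(2)] lie_action_closed[OF N M b n(1) m]
        by (simp add: \<xi>\<xi>_inl[OF u] kk_inl[OF u])
    qed
    ultimately show "ellis_compatible M N actMN actNM" by (simp add: ellis_compatible_def)
  next
    assume ellis: "ellis_compatible M N actMN actNM"
    let ?EM = "semidirect N M actNM" and ?EN = "semidirect M N actMN"
    define kM :: "'m \<Rightarrow> 'm \<times> 'n" where "kM = (\<lambda>m. (m, \<zero>\<^bsub>N\<^esub>))"
    define sN :: "'n \<Rightarrow> 'm \<times> 'n" where "sN = (\<lambda>n. (\<zero>\<^bsub>M\<^esub>, n))"
    define kN :: "'n \<Rightarrow> 'n \<times> 'm" where "kN = (\<lambda>n. (n, \<zero>\<^bsub>M\<^esub>))"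
    define sM :: "'m \<Rightarrow> 'n \<times> 'm" where "sM = (\<lambda>m. (\<zero>\<^bsub>N\<^esub>, m))"
    note folds = kM_def[symmetric] sN_def[symmetric] kN_def[symmetric] sM_def[symmetric]
    note EM = lie_algebra_semidirect[OF N M b] and EN = lie_algebra_semidirect[OF M N a]
    have kM: "kM \<in> lie_hom R M ?EM" and sN: "sN \<in> lie_hom R N ?EM"
      unfolding kM_def sN_def by (rule semidirect_inr_hom[OF N M b] semidirect_inl_hom[OF N M b])+
    have kN: "kN \<in> lie_hom R N ?EN" and sM: "sM \<in> lie_hom R M ?EN"
      unfolding kN_def sM_def by (rule semidirect_inr_hom[OF M N a] semidirect_inl_hom[OF M N a])+
    note cM = M N EM kM sN and cN = M N EN sM kN
    note cM' = N M EM sN kM and cN' = N M EN kN sM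
    \<comment> \<open>\<phi> and \<phi>' are the canonical morphisms from M + N to the semi-direct
      products with ideal \<open>M\<close> and with ideal \<open>N\<close>.\<close>
    define \<phi> where "\<phi> = copair ?EM kM sN"
    define \<phi>' where "\<phi>' = copair ?EN sM kN"
    have \<phi>: "\<phi> \<in> lie_hom R ?P ?EM" unfolding \<phi>_def by (rule copair_hom[OF cM])
    have \<phi>': "\<phi>' \<in> lie_hom R ?P ?EN" unfolding \<phi>'_def by (rule copair_hom[OF cN])
    have \<phi>_k: "\<phi> (?iM m) = kM m" "\<phi>' (?iM m) = sM m" if "m \<in> carrier M" for m
      using copair_inl_apply[OF cM that] copair_inl_apply[OF cN that]
      by (simp_all add: \<phi>_def \<phi>'_def)
    have \<phi>_k': "\<phi> (?iN n) = sN n" "\<phi>' (?iN n) = kN n" if "n \<in> carrier N" for n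
      using copair_inr_apply[OF cM that] copair_inr_apply[OF cN that]
      by (simp_all add: \<phi>_def \<phi>'_def)
    note \<phi>_simps = \<phi>_k[unfolded kM_def sM_def] and \<phi>_simps' = \<phi>_k'[unfolded kN_def sN_def]
    note \<phi>\<phi> = \<phi>_simps \<phi>_simps'
    \<comment> \<open>\<open>\<xi>NM\<close> is defined on a subalgebra of N + M, so its defining
      morphism must be compared with \<phi> across the identification.\<close>
    have \<phi>_swap: "\<phi> (?swap z) = copair ?EM sN kM z" "\<phi>' (?swap z) = copair ?EN kN sM z"
      if z: "z \<in> carrier (coproduct R N M)" for z
    proof -
      have "(\<phi> \<circ> ?swap) z = copair ?EM sN kM z"
        by (rule coproduct_hom_eqI[OF N M lie_hom_comp[OF swap \<phi>] copair_hom[OF cM'] _ _ z])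
          (simp_all add: copair_inl_apply[OF cM'] copair_inr_apply[OF cM'] coprod_swap_def
            copair_inl_apply[OF sw] copair_inr_apply[OF sw] \<phi>_k \<phi>_k')
      moreover have "(\<phi>' \<circ> ?swap) z = copair ?EN kN sM z"
        by (rule coproduct_hom_eqI[OF N M lie_hom_comp[OF swap \<phi>'] copair_hom[OF cN'] _ _ z])
          (simp_all add: copair_inl_apply[OF cN'] copair_inr_apply[OF cN'] coprod_swap_def
            copair_inl_apply[OF sw] copair_inr_apply[OF sw] \<phi>_k \<phi>_k')
      ultimately show "\<phi> (?swap z) = copair ?EM sN kM z" "\<phi>' (?swap z) = copair ?EN kN sM z" by simp_all
    qed
    \<comment> \<open>The two instances of the symmetric context: first X = M and Y = N, then the
      reverse.\<close>
    note halfM = N M b P iM iN \<phi> \<phi>_simps(1) \<phi>_simps'(1)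
    note halfN = M N a P iN iM \<phi>' \<phi>_simps'(2) \<phi>_simps(2)
    define \<xi>M where "\<xi>M = (\<lambda>w. fst (copair ?EM \<phi> (\<lambda>m. (m, \<zero>\<^bsub>N\<^esub>)) w))"
    define \<xi>N where "\<xi>N = (\<lambda>w. fst (copair ?EN \<phi>' (\<lambda>n. (n, \<zero>\<^bsub>M\<^esub>)) w))"
    have "same_morphism (cosmash3 R M N M)
      (\<xi>M \<circ> cosmash3_incl_flat R M N M) (\<xi>NM \<circ> cosmash_incl_flat R N M \<circ> fold_MNM R M N)"
    proof (rule same_morphismI)
      fix x assume x: "x \<in> carrier (cosmash3 R M N M)"
      \<comment> \<open>Here \<psi> identifies M + N with N + M; extended by the inclusion of the
        last \<open>M\<close> it folds the two copies of \<open>M\<close>.\<close>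
      have \<psi>: "copair (coproduct R N M) (coprod_inr R N M) (coprod_inl R N M) \<in> lie_hom R ?P (coproduct R N M)"
        by (simp add: M N coproduct_hom_simps)
      have fac: "copair ?EM sN kM (copair (coproduct R N M) (coprod_inr R N M) (coprod_inl R N M) u) = \<phi> u"
        if u: "u \<in> carrier ?P" for u
        using coproduct_hom_eqI[OF M N lie_hom_comp[OF \<psi> copair_hom[OF cM']] \<phi> _ _ u]
        by (simp add: copair_inl_apply[OF cM'] copair_inr_apply[OF cM'] \<phi>_k \<phi>_k'
            M N coproduct_hom_simps)
      have eq: "fold_MNM R M N x = copair (coproduct R N M)
          (copair (coproduct R N M) (coprod_inr R N M) (coprod_inl R N M)) (coprod_inr R N M) x"
        using x by (simp add: fold_MNM_def cosmash3_incl_def copair3_def)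
      note f = fold_MNM_cosmash[OF M N x]
      have "\<xi>M x = \<xi>NM (fold_MNM R M N x)"
        unfolding \<xi>M_def \<xi>NM_def eq
        by (rule induced_action_fold[OF halfM \<psi> fac[unfolded sN_def kM_def] cosmash3_flat[OF M N M x]])
          (use f in \<open>auto simp: eq[symmetric] cosmash_carrier flat_carrier\<close>)
      then show "(\<xi>M \<circ> cosmash3_incl_flat R M N M) x = (\<xi>NM \<circ> cosmash_incl_flat R N M \<circ> fold_MNM R M N) x"
        using x f by (simp add: cosmash3_incl_flat_def cosmash3_incl_def cosmash_incl_flat_def)
    qed
    moreover have "same_morphism (cosmash3 R M N N)
      (\<xi>N \<circ> cosmash3_incl_flat R M N N) (\<xi>MN \<circ> cosmash_incl_flat R M N \<circ> fold_MNN R M N)"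
    proof (rule same_morphismI)
      fix x assume x: "x \<in> carrier (cosmash3 R M N N)"
      \<comment> \<open>This \<psi> is the identity morphism of M + N, written as an induced
        morphism to match the definition of the folding.\<close>
      have \<psi>: "copair ?P ?iM ?iN \<in> lie_hom R ?P ?P"
        by (simp add: M N coproduct_hom_simps)
      have fac: "copair ?EN sM kN (copair ?P ?iM ?iN u) = \<phi>' u"
        if u: "u \<in> carrier ?P" for u
        using coproduct_hom_eqI[OF M N lie_hom_comp[OF \<psi> copair_hom[OF cN]] \<phi>' _ _ u]
        by (simp add: copair_inl_apply[OF cN] copair_inr_apply[OF cN] \<phi>_k \<phi>_k'
            M N coproduct_hom_simps)
      have eq: "fold_MNN R M N x = copair ?P (copair ?P ?iM ?iN) ?iN x"
        using x by (simp add: fold_MNN_def cosmash3_incl_def copair3_def)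
      note f = fold_MNN_cosmash[OF M N x]
      have "\<xi>N x = \<xi>MN (fold_MNN R M N x)"
        unfolding \<xi>N_def \<xi>MN_def eq
        by (rule induced_action_fold[OF halfN \<psi> fac[unfolded sM_def kN_def] cosmash3_flat[OF M N N x]])
          (use f in \<open>auto simp: eq[symmetric] cosmash_carrier flat_carrier\<close>)
      then show "(\<xi>N \<circ> cosmash3_incl_flat R M N N) x = (\<xi>MN \<circ> cosmash_incl_flat R M N \<circ> fold_MNN R M N) x"
        using x f by (simp add: cosmash3_incl_flat_def cosmash3_incl_def cosmash_incl_flat_def)
    qed
    moreover have "same_morphism (flat R ?K M) (\<xi>M \<circ> flat_map R ?K M ?P M ?\<xi>\<xi> id)
        (\<xi>M \<circ> flat_map R ?K M ?P M ?kk id)"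
      unfolding \<xi>M_def
    proof (rule induced_action_agree[OF halfM F G h\<xi>\<xi> hkk])
      fix u m assume u: "u \<in> carrier ?F" "m \<in> carrier M"
      \<comment> \<open>On \<open>?F\<close> the two images under \<phi> coincide outright: this is
        the defining equation of \<open>\<xi>NM\<close>.\<close>
      have "\<phi> (?kk (coprod_inl R ?F ?G u)) = \<phi> (?\<xi>\<xi> (coprod_inl R ?F ?G u))"
        using u corresponding_internal_action_apply(2)[OF N M b u(1)]
        by (simp add: kk_inl \<xi>\<xi>_inl \<phi>_swap(1) flat_subset[OF N M] \<phi>\<phi> \<xi>_simps folds)
          (simp add: \<xi>NM_def kM_def)
      then show "\<phi> (?\<xi>\<xi> (coprod_inl R ?F ?G u)) \<otimes>\<^bsub>?EM\<^esub> (m, \<zero>\<^bsub>N\<^esub>) =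
          \<phi> (?kk (coprod_inl R ?F ?G u)) \<otimes>\<^bsub>?EM\<^esub> (m, \<zero>\<^bsub>N\<^esub>)" by simp
    next
      fix u m assume u: "u \<in> carrier ?G" "m \<in> carrier M"
      \<comment> \<open>On \<open>?G\<close> only the brackets with \<open>M\<close> are compared;
        this is where the Ellis condition enters.\<close>
      have "\<phi> u \<otimes>\<^bsub>?EM\<^esub> (m, \<zero>\<^bsub>N\<^esub>) = (actNM (\<xi>MN u) m, \<zero>\<^bsub>N\<^esub>)"
        unfolding \<phi>_def kM_def sN_def \<xi>MN_def
        by (rule ellis_flat_bracket[OF M N b a _ u]) (use ellis in \<open>simp add: ellis_compatible_def\<close>)
      then show "\<phi> (?\<xi>\<xi> (coprod_inr R ?F ?G u)) \<otimes>\<^bsub>?EM\<^esub> (m, \<zero>\<^bsub>N\<^esub>) =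
          \<phi> (?kk (coprod_inr R ?F ?G u)) \<otimes>\<^bsub>?EM\<^esub> (m, \<zero>\<^bsub>N\<^esub>)"
        using u semidirect_bracket_inr[OF N M b, of "(\<zero>\<^bsub>M\<^esub>, \<xi>MN u)" m]
        by (simp add: \<xi>\<xi>_inr kk_inr \<phi>\<phi> \<xi>_simps lie_action_closed[OF N M b] del: semidirect_simps(5))
    qed
    moreover have "same_morphism (flat R ?K N) (\<xi>N \<circ> flat_map R ?K N ?P N ?\<xi>\<xi> id)
        (\<xi>N \<circ> flat_map R ?K N ?P N ?kk id)"
      unfolding \<xi>N_def
    proof (rule induced_action_agree[OF halfN F G h\<xi>\<xi> hkk])
      fix u n assume u: "u \<in> carrier ?F" "n \<in> carrier N"
      \<comment> \<open>For (CA.N) the summands exchange roles. By \<open>\<phi>_swap\<close> the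
        left side is the morphism induced on N + M by \<open>kN\<close> and \<open>sM\<close>, as
        \<open>ellis_flat_bracket\<close> requires.\<close>
      have "\<phi>' (?swap u) \<otimes>\<^bsub>?EN\<^esub> (n, \<zero>\<^bsub>M\<^esub>) = (actMN (\<xi>NM u) n, \<zero>\<^bsub>M\<^esub>)"
        unfolding \<phi>_swap(2)[OF flat_subset[OF N M u(1)]] kN_def sM_def \<xi>NM_def
        by (rule ellis_flat_bracket[OF N M a b _ u]) (use ellis in \<open>simp add: ellis_compatible_def\<close>)
      then show "\<phi>' (?\<xi>\<xi> (coprod_inl R ?F ?G u)) \<otimes>\<^bsub>?EN\<^esub> (n, \<zero>\<^bsub>M\<^esub>) =
          \<phi>' (?kk (coprod_inl R ?F ?G u)) \<otimes>\<^bsub>?EN\<^esub> (n, \<zero>\<^bsub>M\<^esub>)"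
        using u semidirect_bracket_inr[OF M N a, of "(\<zero>\<^bsub>N\<^esub>, \<xi>NM u)" n]
        by (simp add: \<xi>\<xi>_inl kk_inl \<phi>\<phi> \<xi>_simps lie_action_closed[OF M N a] del: semidirect_simps(5))
    next
      fix u n assume u: "u \<in> carrier ?G" "n \<in> carrier N"
      have "\<phi>' (?kk (coprod_inr R ?F ?G u)) = \<phi>' (?\<xi>\<xi> (coprod_inr R ?F ?G u))"
        using u corresponding_internal_action_apply(2)[OF M N a u(1)]
        by (simp add: kk_inr \<xi>\<xi>_inr \<phi>\<phi> \<xi>_simps folds) (simp add: \<phi>'_def \<xi>MN_def kN_def)
      then show "\<phi>' (?\<xi>\<xi> (coprod_inr R ?F ?G u)) \<otimes>\<^bsub>?EN\<^esub> (n, \<zero>\<^bsub>M\<^esub>) =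
          \<phi>' (?kk (coprod_inr R ?F ?G u)) \<otimes>\<^bsub>?EN\<^esub> (n, \<zero>\<^bsub>M\<^esub>)" by simp
    qed
    moreover note induced_action[OF halfM, folded \<xi>M_def] induced_action[OF halfN, folded \<xi>N_def]
      induced_action_iY[OF halfM, folded \<xi>M_def \<xi>NM_def] induced_action_iY[OF halfN, folded \<xi>N_def \<xi>MN_def]
      induced_action_iX[OF halfM, folded \<xi>M_def] induced_action_iX[OF halfN, folded \<xi>N_def]
    ultimately show "internally_compatible R M N (corresponding_internal_action R M N actMN)
        (corresponding_internal_action R N M actNM)"
      unfolding internally_compatible_def Let_def \<xi>MN_def[symmetric] \<xi>NM_def[symmetric]
      using actMN actNM by blast
  qed
qed

end
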